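(* Assume that at least one of the following two conditions holds: (i) $\gamma_*\ge1$ and the function $S$ has at most finitely many zero points on $D$; (ii) the function $S$ is either positive on all of $D$ or negative on all of $D$. If $\varlimsup_{p\to\infty}O_p(f,D)/N^p=+\infty$, then \[ \underline{\dim}_B\,\Gamma f\;\ge\;1+\frac{\log\rho_*}{\log N}. \]
   Context: Grid. Let $N\ge 2$ be an integer, and let $x_0<x_1<\cdots<x_N$ and $y_0<y_1<\cdots<y_N$ be real numbers with $x_i-x_{i-1}=(x_N-x_0)/N$ and $y_i-y_{i-1}=(y_N-y_0)/N$ for $1\le i\le N$, and $x_N-x_0=y_N-y_0$. Put $I=[x_0,x_N]$, $J=[y_0,y_N]$, $D=I\times J$, $I_i=[x_{i-1},x_i]$, $J_j=[y_{j-1},y_j]$. For $1\le i\le N$ let $u_i:I\to I_i$ be the affine map with $u_i(x_0)=x_{i-1}$, $u_i(x_N)=x_i$ if $i$ is odd, and $u_i(x_0)=x_i$, $u_i(x_N)=x_{i-1}$ if $i$ is even; let $v_j:J\to J_j$ be the affine map with $v_j(y_0)=y_{j-1}$, $v_j(y_N)=y_j$ if $j$ is odd, and $v_j(y_0)=y_j$, $v_j(y_N)=y_{j-1}$ if $j$ is even. Let $\Sigma=\{1,\dots,N\}\times\{1,\dots,N\}$. For $w=(i,j)\in\Sigma$ let $D_w=I_i\times J_j$ and $L_w:D\to D_w$, $L_w(x,y)=(u_i(x),v_j(y))$. The function $f$. Let $z_{ij}\in\mathbb{R}$ ($0\le i,j\le N$) be given. Let $g,h,S:D\to\mathbb{R}$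 be continuous with $g(x_i,y_j)=z_{ij}$ for $i,j\in\{0,N\}$, $h(x_i,y_j)=z_{ij}$ for all $0\le i,j\le N$, and $|S(x,y)|<1$ for all $(x,y)\in D$. Define $q:D\to\mathbb{R}$ by $q(x,y)=h(x,y)-S(x,y)\,g(L_w^{-1}(x,y))$ for $(x,y)\in D_w$, $w\in\Sigma$ (this is well defined and continuous). For $w=(i,j)\in\Sigma$ let $F_w(x,y,z)=S(L_w(x,y))\,z+q(L_w(x,y))$ and $\Psi_w(x,y,z)=(u_i(x),v_j(y),F_w(x,y,z))$ on $D\times\mathbb{R}$. It is known that there is a unique continuous $f:D\to\mathbb{R}$ with $f(x_i,y_j)=z_{ij}$ for all $0\le i,j\le N$ whose graph $\Gamma f=\{(x,y,f(x,y)):(x,y)\in D\}$ satisfies $\Gamma f=\bigcup_{w\in\Sigma}\Psi_w(\Gamma f)$; thus $f(x,y)=S(x,y)f(L_w^{-1}(x,y))+q(x,y)$ for $(x,y)\in D_w$. $\Gamma f$ is called a generalized affine fractal interpolation surface and $S$ its vertical scaling function. Assume that $S$ and $q$ are Lipschitz on $D$: there are $\lambda_S,\lambda_q>0$ with $|S(t_1)-S(t_2)|\le\lambda_S|t_1-t_2|$ and $|q(t_1)-q(t_2)|\le\lambda_q|t_1-t_2|$ for all $t_1,t_2\in D$. Sum function. $\gamma(x,y)=\sum_{w\in\Sigma}|S(L_w(x,y))|$ for $(x,y)\in D$, and $\gamma_*=\min_{(x,y)\in D}\gamma(x,y)$. Words. For $n\ge1$, $\Sigma^n$ is the set of words $\mathbf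 w=w_1\cdots w_n$ with letters in $\Sigma$; $\Sigma^0$ consists of the empty word. For $\mathbf w=w_1\cdots w_n\in\Sigma^n$ put $\sigma(\mathbf w)=w_2\cdots w_n\in\Sigma^{n-1}$, $L_{\mathbf w}=L_{w_1}\circ\cdots\circ L_{w_n}$, $D_{\mathbf w}=L_{\mathbf w}(D)$. Juxtaposition denotes concatenation. Oscillation sums. For $E\subset D$, $O(f,E)=\sup\{f(\mathbf x')-f(\mathbf x''):\mathbf x',\mathbf x''\in E\}$, and $O_p(f,D)=\sum_{\mathbf w\in\Sigma^p}O(f,D_{\mathbf w})$ for $p\ge1$. Vertical scaling matrix and $\rho_*$. For a word $\mathbf w$ put $\underline s_{\mathbf w}=\inf_{t\in D_{\mathbf w}}|S(t)|$. For $n\ge1$, $\underline M_n$ is the $\Sigma^n\times\Sigma^n$ matrix with $(\underline M_n)_{\mathbf i,\mathbf j}=\underline s_{\mathbf i j_n}$ if $\sigma(\mathbf i)=j_1\cdots j_{n-1}$ and $0$ otherwise, where $\mathbf i=i_1\cdots i_n$, $\mathbf j=j_1\cdots j_n$. With $\rho(A)$ denoting the spectral radius of a square matrix $A$, it is known that $\rho(\underline M_n)$ is nondecreasing in $n$ and bounded; put $\rho_*=\lim_{n\to\infty}\rho(\underline M_n)$. Box dimension. For $\varepsilon>0$ and bounded $E\subset\mathbb{R}^d$, let $\mathcal N_E(\varepsilon)$ be the number of cubes $\prod_{i=1}^d[n_i\varepsilon,(n_i+1)\varepsilon]$, $n_i\in\mathbb{Z}$, intersecting $E$; $\underline{\dim}_B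 E=\varliminf_{\varepsilon\to0}\frac{\log\mathcal N_E(\varepsilon)}{\log(1/\varepsilon)}$. *)

theory Defs
  imports "HOL-Analysis.Analysis" "Jordan_Normal_Form.Spectral_Radius"
begin

definition rect_domain :: "nat \<Rightarrow> (nat \<Rightarrow> real) \<Rightarrow> (nat \<Rightarrow> real) \<Rightarrow> (real \<times> real) set" where
  "rect_domain N x y = {x 0..x N} \<times> {y 0..y N}"

text \<open>The affine map of \<open>[a 0, a N]\<close> onto \<open>[a (i - 1), a i]\<close>, orientation preserving for odd
  \<open>i\<close> and orientation reversing for even \<open>i\<close>. Both \<open>u\<^sub>i\<close> and \<open>v\<^sub>j\<close> are instances of it.\<close>

definition fold_map :: "nat \<Rightarrow> (nat \<Rightarrow> real) \<Rightarrow> nat \<Rightarrow> real \<Rightarrow> real" where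
  "fold_map N a i t =
     (if odd i then a (i - 1) + (a i - a (i - 1)) * (t - a 0) / (a N - a 0)
      else a i + (a (i - 1) - a i) * (t - a 0) / (a N - a 0))"

lemma fold_map_endpoints:
  assumes "a 0 < a N"
  shows "odd i \<Longrightarrow> fold_map N a i (a 0) = a (i - 1)" "odd i \<Longrightarrow> fold_map N a i (a N) = a i"
    and "even i \<Longrightarrow> fold_map N a i (a 0) = a i" "even i \<Longrightarrow> fold_map N a i (a N) = a (i - 1)"
  using assms by (auto simp: fold_map_def)

definition letters :: "nat \<Rightarrow> (nat \<times> nat) set" where
  "letters N = {1..N} \<times> {1..N}"

definition cell :: "(nat \<Rightarrow> real) \<Rightarrow> (nat \<Rightarrow> real) \<Rightarrow> nat \<times> nat \<Rightarrow> (real \<times> real) set" where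
  "cell x y w = {x (fst w - 1)..x (fst w)} \<times> {y (snd w - 1)..y (snd w)}"

definition cell_map ::
  "nat \<Rightarrow> (nat \<Rightarrow> real) \<Rightarrow> (nat \<Rightarrow> real) \<Rightarrow> nat \<times> nat \<Rightarrow> real \<times> real \<Rightarrow> real \<times> real" where
  "cell_map N x y w t = (fold_map N x (fst w) (fst t), fold_map N y (snd w) (snd t))"

definition graph_map ::
  "nat \<Rightarrow> (nat \<Rightarrow> real) \<Rightarrow> (nat \<Rightarrow> real) \<Rightarrow> (real \<times> real \<Rightarrow> real) \<Rightarrow> (real \<times> real \<Rightarrow> real)
     \<Rightarrow> nat \<times> nat \<Rightarrow> real \<times> real \<times> real \<Rightarrow> real \<times> real \<times> real" where
  "graph_map N x y S q w = (\<lambda>(s, t, r).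
     (fold_map N x (fst w) s, fold_map N y (snd w) t,
      S (cell_map N x y w (s, t)) * r + q (cell_map N x y w (s, t))))"

definition graph_over :: "(real \<times> real) set \<Rightarrow> (real \<times> real \<Rightarrow> real) \<Rightarrow> (real \<times> real \<times> real) set" where
  "graph_over D f = {(s, t, f (s, t)) | s t. (s, t) \<in> D}"

definition sum_fun ::
  "nat \<Rightarrow> (nat \<Rightarrow> real) \<Rightarrow> (nat \<Rightarrow> real) \<Rightarrow> (real \<times> real \<Rightarrow> real) \<Rightarrow> real \<times> real \<Rightarrow> real" where
  "sum_fun N x y S t = (\<Sum>w\<in>letters N. \<bar>S (cell_map N x y w t)\<bar>)"

text \<open>The infimum is a minimum, since \<open>S\<close> is continuous on the compact domain.\<close>

definition sum_fun_min ::
  "nat \<Rightarrow> (nat \<Rightarrow> real) \<Rightarrow> (nat \<Rightarrow> real) \<Rightarrow> (real \<times> real \<Rightarrow> real) \<Rightarrow> real" where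
  "sum_fun_min N x y S = (INF t\<in>rect_domain N x y. sum_fun N x y S t)"

definition words :: "nat \<Rightarrow> nat \<Rightarrow> (nat \<times> nat) list set" where
  "words N n = {w. set w \<subseteq> letters N \<and> length w = n}"

definition word_map ::
  "nat \<Rightarrow> (nat \<Rightarrow> real) \<Rightarrow> (nat \<Rightarrow> real) \<Rightarrow> (nat \<times> nat) list \<Rightarrow> real \<times> real \<Rightarrow> real \<times> real" where
  "word_map N x y ws = foldr (\<lambda>w F. cell_map N x y w \<circ> F) ws id"

definition word_cell ::
  "nat \<Rightarrow> (nat \<Rightarrow> real) \<Rightarrow> (nat \<Rightarrow> real) \<Rightarrow> (nat \<times> nat) list \<Rightarrow> (real \<times> real) set" where
  "word_cell N x y w = word_map N x y w ` rect_domain N x y"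

definition osc :: "('a \<Rightarrow> real) \<Rightarrow> 'a set \<Rightarrow> real" where
  "osc f E = (SUP (s, t)\<in>E \<times> E. f s - f t)"

definition osc_sum ::
  "nat \<Rightarrow> (nat \<Rightarrow> real) \<Rightarrow> (nat \<Rightarrow> real) \<Rightarrow> (real \<times> real \<Rightarrow> real) \<Rightarrow> nat \<Rightarrow> real" where
  "osc_sum N x y f p = (\<Sum>w\<in>words N p. osc f (word_cell N x y w))"

definition lower_scale ::
  "nat \<Rightarrow> (nat \<Rightarrow> real) \<Rightarrow> (nat \<Rightarrow> real) \<Rightarrow> (real \<times> real \<Rightarrow> real) \<Rightarrow> (nat \<times> nat) list \<Rightarrow> real" where
  "lower_scale N x y S w = (INF t\<in>word_cell N x y w. \<bar>S t\<bar>)"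

text \<open>Matrices of the library are indexed by natural numbers, so the words of length \<open>n\<close> are
  enumerated; the spectral radius does not depend on the order of the enumeration.\<close>

definition word_list :: "nat \<Rightarrow> nat \<Rightarrow> (nat \<times> nat) list list" where
  "word_list N n = List.n_lists n (List.product [1..<Suc N] [1..<Suc N])"

lemma set_word_list: "set (word_list N n) = words N n"
  by (auto simp: word_list_def words_def letters_def set_n_lists)

lemma distinct_word_list: "distinct (word_list N n)"
  unfolding word_list_def by (intro distinct_n_lists distinct_product distinct_upt)

definition lower_entry ::
  "nat \<Rightarrow> (nat \<Rightarrow> real) \<Rightarrow> (nat \<Rightarrow> real) \<Rightarrow> (real \<times> real \<Rightarrow> real)
     \<Rightarrow> (nat \<times> nat) list \<Rightarrow> (nat \<times> nat) list \<Rightarrow> real" where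
  "lower_entry N x y S i j =
     (if tl i = butlast j then lower_scale N x y S (i @ [last j]) else 0)"

definition lower_matrix ::
  "nat \<Rightarrow> (nat \<Rightarrow> real) \<Rightarrow> (nat \<Rightarrow> real) \<Rightarrow> (real \<times> real \<Rightarrow> real) \<Rightarrow> nat \<Rightarrow> complex mat" where
  "lower_matrix N x y S n =
     (let ws = word_list N n in
      Matrix.mat (length ws) (length ws)
        (\<lambda>(a, b). complex_of_real (lower_entry N x y S (ws ! a) (ws ! b))))"

text \<open>The matrices are meaningful for \<open>n \<ge> 1\<close> only; the value at \<open>n = 0\<close> does not affect the limit.\<close>

definition rho_star ::
  "nat \<Rightarrow> (nat \<Rightarrow> real) \<Rightarrow> (nat \<Rightarrow> real) \<Rightarrow> (real \<times> real \<Rightarrow> real) \<Rightarrow> real" where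
  "rho_star N x y S = lim (\<lambda>n. spectral_radius (lower_matrix N x y S n))"

definition mesh_cubes :: "real \<Rightarrow> 'a::euclidean_space set set" where
  "mesh_cubes \<epsilon> = {cbox (\<Sum>b\<in>Basis. (real_of_int (n b) * \<epsilon>) *\<^sub>R b)
                        (\<Sum>b\<in>Basis. ((real_of_int (n b) + 1) * \<epsilon>) *\<^sub>R b) | n. True}"

definition mesh_count :: "'a::euclidean_space set \<Rightarrow> real \<Rightarrow> nat" where
  "mesh_count E \<epsilon> = card {Q \<in> mesh_cubes \<epsilon>. Q \<inter> E \<noteq> {}}"

definition lower_box_dim :: "'a::euclidean_space set \<Rightarrow> ereal" where
  "lower_box_dim E =
     Liminf (at_right 0) (\<lambda>\<epsilon>. ereal (ln (real (mesh_count E \<epsilon>)) / ln (1 / \<epsilon>)))"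

end

theory Submission
  imports Defs
begin

text \<open>
  The self-affinity of the graph says \<open>f (L\<^sub>a t) = S (L\<^sub>a t) f t + q (L\<^sub>a t)\<close>. Hence the oscillation of
  \<open>f\<close> on the cell of a word \<open>a # v\<close> is at least the least value of \<open>|S|\<close> there times its oscillation
  on the cell of \<open>v\<close>, up to an error of the order of the diameter of the cell
  (\<open>cell_osc_Cons\<close>). Let \<open>V\<^sub>p i\<close> be the sum of the oscillations over the cells of the words \<open>i @ u\<close> with
  \<open>|u| = p\<close>. Summing up, the vectors \<open>V\<^sub>p\<close> indexed by the words of length \<open>n\<close> satisfy
  \<open>V\<^sub>p\<^sub>+\<^sub>1 \<ge> M\<^sub>n V\<^sub>p - K N\<^sup>p\<close> (\<open>local_osc_sum_Suc\<close>), where \<open>M\<^sub>n\<close> is the vertical scaling matrix with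
  spectral radius \<open>\<rho>\<^sub>n\<close>.

  The absolute values of a left eigenvector of \<open>M\<^sub>n\<close> give weights \<open>l \<ge> 0\<close> with \<open>l M\<^sub>n \<ge> \<rho>\<^sub>n l\<close>, so the
  weighted sum \<open>l \<bullet> V\<^sub>p\<close> is multiplied by almost \<open>\<rho>\<^sub>n\<close> in each step. If \<open>\<rho>\<^sub>n > N\<close>, then \<open>l \<bullet> V\<^sub>p\<close>
  grows like \<open>\<rho>\<^sub>n\<^sup>p\<close>, provided that it once exceeds a certain multiple of \<open>N\<^sup>p\<close>
  (\<open>osc_sum_growth\<close>). Since the support of \<open>l\<close> is unknown, this requires that \<open>V\<^sub>p w / N\<^sup>p\<close> is
  unbounded for every single word \<open>w\<close>; such words are called rough below. The hypothesis on the
  oscillation sums says that the empty word is rough. If \<open>S\<close> has no zero, roughness passes from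
  \<open>v\<close> to \<open>a # v\<close> for every letter \<open>a\<close>. In the other case consider the points all of whose small cells
  are rough. Their set is mapped into itself by every \<open>L\<^sub>a\<close>, except for points sent to a zero of \<open>S\<close>.
  From \<open>\<gamma> \<ge> 1\<close> and \<open>|S| < 1\<close> each of its points has at least two letters with nonzero scaling, and a
  counting argument that takes care of points on the border of the square
  (\<open>no_finite_invariant_set\<close>) shows that it is infinite. As \<open>S\<close> has finitely many zeros, infinitely
  many rough points remain in every cell.

  Finally, the number of mesh cubes of side \<open>\<epsilon>\<close> meeting the graph is at least a quarter of the sum of
  \<open>max 1 (osc / \<epsilon>)\<close> over the cells of a generation \<open>p\<close> whose side is at least \<open>\<epsilon>\<close>
  (\<open>osc_sum_le_mesh_count\<close>). This yields the lower bounds 2 and, for \<open>\<rho>\<^sub>n > N\<close>,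
  \<open>1 + log \<rho>\<^sub>n / log N\<close> for the dimension. The sequence \<open>\<rho>\<^sub>n\<close> increases to its limit \<open>\<rho>\<^sub>*\<close> by a
  Collatz--Wielandt argument (\<open>radius_mono\<close>).
\<close>

section \<open>Spectral radii of nonnegative matrices\<close>

lemma spectral_radius_nonneg:
  assumes "A \<in> carrier_mat n n" "n > 0"
  shows "0 \<le> spectral_radius A"
  using spectral_radius_mem_max(1)[OF assms] by auto

text \<open>Take the absolute values of the coordinates of an eigenvector for an eigenvalue of greatest
  modulus: for a nonnegative matrix the triangle inequality is the claim.\<close>

lemma right_subeigenvector_exists:
  fixes m :: "nat \<Rightarrow> nat \<Rightarrow> real" and n :: nat
  defines "A \<equiv> Matrix.mat n n (\<lambda>(i, j). complex_of_real (m i j))"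
  assumes m: "\<And>i j. i < n \<Longrightarrow> j < n \<Longrightarrow> 0 \<le> m i j" and n: "n > 0"
  obtains v where "\<And>i. 0 \<le> v i" "\<exists>i<n. 0 < v i"
    "\<And>i. i < n \<Longrightarrow> spectral_radius A * v i \<le> (\<Sum>j<n. m i j * v j)"
proof -
  have A: "A \<in> carrier_mat n n" by (simp add: A_def)
  from spectral_radius_mem_max(1)[OF A n] obtain k where
    k: "eigenvalue A k" "norm k = spectral_radius A"
    by (auto simp: spectrum_def)
  from k(1) obtain z where z: "z \<in> carrier_vec n" "z \<noteq> 0\<^sub>v n" "A *\<^sub>v z = k \<cdot>\<^sub>v z"
    using A by (auto simp: eigenvalue_def eigenvector_def)
  define v where "v i = norm (z $ i)" for i
  have "\<exists>i<n. 0 < v i"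
  proof (rule ccontr)
    assume "\<not> (\<exists>i<n. 0 < v i)"
    then have "z = 0\<^sub>v n" using z(1) by (intro eq_vecI) (auto simp: v_def)
    then show False using z(2) by simp
  qed
  moreover have "spectral_radius A * v i \<le> (\<Sum>j<n. m i j * v j)" if i: "i < n" for i
  proof -
    have "(A *\<^sub>v z) $ i = (\<Sum>j<n. of_real (m i j) * z $ j)"
      using i z(1) A by (auto simp: A_def scalar_prod_def atLeast0LessThan intro!: sum.cong)
    then have "k * z $ i = (\<Sum>j<n. of_real (m i j) * z $ j)"
      using z i by simp
    then have "norm k * v i = norm (\<Sum>j<n. of_real (m i j) * z $ j)"
      unfolding v_def norm_mult[symmetric] by (rule arg_cong)
    also have "\<dots> \<le> (\<Sum>j<n. m i j * v j)"
      using m i by (intro sum_norm_le) (auto simp: norm_mult v_def)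
    finally show ?thesis using k by simp
  qed
  ultimately show thesis using that[of v] by (auto simp: v_def)
qed

lemma spectral_radius_transpose:
  assumes A: "A \<in> carrier_mat n n"
  shows "spectral_radius (transpose_mat A) = spectral_radius A"
proof -
  have T: "transpose_mat A \<in> carrier_mat n n" using A by simp
  show ?thesis
    unfolding spectral_radius_def spectrum_root_char_poly[OF A] spectrum_root_char_poly[OF T]
    using char_poly_transpose_mat[OF A] by simp
qed

lemma left_subeigenvector_exists:
  fixes m :: "nat \<Rightarrow> nat \<Rightarrow> real" and n :: nat
  defines "A \<equiv> Matrix.mat n n (\<lambda>(i, j). complex_of_real (m i j))"
  assumes m: "\<And>i j. i < n \<Longrightarrow> j < n \<Longrightarrow> 0 \<le> m i j" and n: "n > 0"
  obtains v where "\<And>i. 0 \<le> v i" "\<exists>i<n. 0 < v i"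
    "\<And>j. j < n \<Longrightarrow> spectral_radius A * v j \<le> (\<Sum>i<n. v i * m i j)"
proof -
  have T: "transpose_mat A = Matrix.mat n n (\<lambda>(i, j). complex_of_real (m j i))"
    by (auto simp: A_def)
  have A: "A \<in> carrier_mat n n" by (simp add: A_def)
  obtain v where "\<And>i. 0 \<le> v i" "\<exists>i<n. 0 < v i"
    "\<And>i. i < n \<Longrightarrow> spectral_radius (transpose_mat A) * v i \<le> (\<Sum>j<n. m j i * v j)"
    unfolding T by (rule right_subeigenvector_exists[of n "\<lambda>i j. m j i"]) (use m n in auto)
  then show thesis
    by (intro that[of v]) (simp_all add: spectral_radius_transpose[OF A] mult.commute)
qed

lemma spectral_radius_smult_less_1:
  assumes A: "A \<in> carrier_mat n n" and n: "n > 0" and r: "spectral_radius A < r"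
  shows "spectral_radius (complex_of_real (1 / r) \<cdot>\<^sub>m A) < 1"
proof -
  have r0: "0 < r" using spectral_radius_nonneg[OF A n] r by simp
  have B: "complex_of_real (1 / r) \<cdot>\<^sub>m A \<in> carrier_mat n n" using A by simp
  from spectral_radius_mem_max(1)[OF B n] obtain k where
    k: "eigenvalue (complex_of_real (1 / r) \<cdot>\<^sub>m A) k"
       "norm k = spectral_radius (complex_of_real (1 / r) \<cdot>\<^sub>m A)"
    by (auto simp: spectrum_def)
  from k(1) obtain z where z: "z \<in> carrier_vec n" "z \<noteq> 0\<^sub>v n"
      "(complex_of_real (1 / r) \<cdot>\<^sub>m A) *\<^sub>v z = k \<cdot>\<^sub>v z"
    using A by (auto simp: eigenvalue_def eigenvector_def)
  have "complex_of_real (1 / r) \<cdot>\<^sub>v (A *\<^sub>v z) = k \<cdot>\<^sub>v z"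
    unfolding z(3)[symmetric]
    by (rule eq_vecI) (use z(1) A in \<open>auto simp: scalar_prod_def sum_distrib_left mult_ac\<close>)
  then have "complex_of_real r \<cdot>\<^sub>v (complex_of_real (1 / r) \<cdot>\<^sub>v (A *\<^sub>v z))
      = complex_of_real r \<cdot>\<^sub>v (k \<cdot>\<^sub>v z)" by simp
  then have "A *\<^sub>v z = (of_real r * k) \<cdot>\<^sub>v z"
    using r0 by (simp add: smult_smult_assoc)
  then have "eigenvalue A (of_real r * k)"
    using z A by (auto simp: eigenvalue_def eigenvector_def)
  then have "norm (of_real r * k) \<le> spectral_radius A"
    by (intro spectral_radius_mem_max(2)[OF A n]) (auto simp: spectrum_def)
  then have "r * norm k \<le> spectral_radius A" using r0 by (simp add: norm_mult)
  then have "r * norm k < r * 1" using r by linarith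
  then show ?thesis using k r0 by (simp only: mult_less_cancel_left_pos)
qed

text \<open>One half of the Collatz--Wielandt formula: if the spectral radius were smaller than \<open>\<rho>\<close>,
  the powers of \<open>A / r\<close> would stay bounded for some \<open>r < \<rho>\<close>, whereas applied to \<open>v\<close> they
  grow at least like \<open>(\<rho> / r)\<^sup>k\<close>.\<close>

lemma spectral_radius_ge_subeigenvector:
  fixes m :: "nat \<Rightarrow> nat \<Rightarrow> real" and n :: nat
  defines "A \<equiv> Matrix.mat n n (\<lambda>(i, j). complex_of_real (m i j))"
  assumes m: "\<And>i j. i < n \<Longrightarrow> j < n \<Longrightarrow> 0 \<le> m i j"
    and v: "\<And>i. i < n \<Longrightarrow> 0 \<le> v i" and k: "k < n" "0 < v k"
    and sub: "\<And>i. i < n \<Longrightarrow> \<rho> * v i \<le> (\<Sum>j<n. m i j * v j)"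
  shows "\<rho> \<le> spectral_radius A"
proof (rule ccontr)
  assume "\<not> \<rho> \<le> spectral_radius A"
  then obtain r where r: "spectral_radius A < r" "r < \<rho>" by (meson dense not_le)
  have n: "n > 0" using k by simp
  have A: "A \<in> carrier_mat n n" by (simp add: A_def)
  have r0: "0 < r" using spectral_radius_nonneg[OF A n] r by simp
  define B where "B = complex_of_real (1 / r) \<cdot>\<^sub>m A"
  have B: "B \<in> carrier_mat n n" using A by (simp add: B_def)
  have B_entry: "B $$ (i, j) = of_real (m i j / r)" if "i < n" "j < n" for i j
    using that by (simp add: B_def A_def)
  define q where "q = \<rho> / r"
  have q: "q > 1" using r r0 by (simp add: q_def)
  have powers: "\<exists>b. (\<forall>i<n. \<forall>j<n. (B ^\<^sub>m p) $$ (i, j) = complex_of_real (b i j) \<and> 0 \<le> b i j)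
      \<and> (\<forall>i<n. q ^ p * v i \<le> (\<Sum>j<n. b i j * v j))" for p
  proof (induction p)
    case 0
    have "v i \<le> (\<Sum>j<n. (if i = j then 1 else 0) * v j)" if "i < n" for i
      using that by (simp add: if_distrib[of "\<lambda>c. c * _"] cong: if_cong)
    then show ?case
      using B by (intro exI[of _ "\<lambda>i j. if i = j then 1 else 0"]) auto
  next
    case (Suc p)
    then obtain b where b: "\<And>i j. i < n \<Longrightarrow> j < n \<Longrightarrow> (B ^\<^sub>m p) $$ (i, j) = complex_of_real (b i j)"
      "\<And>i j. i < n \<Longrightarrow> j < n \<Longrightarrow> 0 \<le> b i j"
      "\<And>i. i < n \<Longrightarrow> q ^ p * v i \<le> (\<Sum>j<n. b i j * v j)" by blast
    define c where "c i j = (\<Sum>l<n. b i l * (m l j / r))" for i j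
    have Bp: "B ^\<^sub>m p \<in> carrier_mat n n" using B by (rule pow_carrier_mat)
    have 1: "(B ^\<^sub>m Suc p) $$ (i, j) = complex_of_real (c i j)" if "i < n" "j < n" for i j
    proof -
      have "(B ^\<^sub>m Suc p) $$ (i, j) = (\<Sum>l<n. (B ^\<^sub>m p) $$ (i, l) * B $$ (l, j))"
        using that B Bp by (simp add: scalar_prod_def atLeast0LessThan)
      also have "\<dots> = of_real (c i j)"
        using that by (simp add: c_def b(1) B_entry)
      finally show ?thesis .
    qed
    have 2: "0 \<le> c i j" if "i < n" "j < n" for i j
      unfolding c_def using that b(2) m r0 by (intro sum_nonneg mult_nonneg_nonneg divide_nonneg_pos) auto
    have 3: "q ^ Suc p * v i \<le> (\<Sum>j<n. c i j * v j)" if i: "i < n" for i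
    proof -
      have "q ^ Suc p * v i = q * (q ^ p * v i)" by simp
      also have "\<dots> \<le> q * (\<Sum>j<n. b i j * v j)"
        using b(3)[OF i] q by (intro mult_left_mono) auto
      also have "\<dots> = (\<Sum>l<n. b i l * (q * v l))"
        by (simp add: sum_distrib_left mult_ac)
      also have "\<dots> \<le> (\<Sum>l<n. b i l * (\<Sum>j<n. m l j / r * v j))"
      proof (intro sum_mono mult_left_mono)
        fix l assume l: "l \<in> {..<n}"
        have "\<rho> * v l / r \<le> (\<Sum>j<n. m l j * v j) / r"
          using sub[of l] l r0 by (intro divide_right_mono) auto
        then show "q * v l \<le> (\<Sum>j<n. m l j / r * v j)"
          by (simp add: q_def sum_divide_distrib)
        show "0 \<le> b i l" using l i b(2) by simp
      qed
      also have "\<dots> = (\<Sum>j<n. c i j * v j)"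
        unfolding c_def sum_distrib_right sum_distrib_left
        by (subst sum.swap) (simp add: mult_ac)
      finally show ?thesis .
    qed
    show ?case using 1 2 3 by blast
  qed
  obtain c where c: "\<And>p. norm_bound (B ^\<^sub>m p) c"
  proof -
    obtain as where as: "char_poly B = (\<Prod>a\<leftarrow>as. [:- a, 1:])"
      using char_poly_factorized[OF B] by blast
    have "spectral_radius B < 1"
      unfolding B_def by (rule spectral_radius_smult_less_1[OF A n r(1)])
    then show thesis
      using that spectral_radius_jnf_norm_bound_less_1[OF B _ jordan_nf_exists[OF B as]] by blast
  qed
  define C where "C = (\<Sum>j<n. c * v j)"
  have bounded: "q ^ p * v k \<le> C" for p
  proof -
    obtain b where b: "\<And>i j. i < n \<Longrightarrow> j < n \<Longrightarrow> (B ^\<^sub>m p) $$ (i, j) = complex_of_real (b i j)"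
      "\<And>i j. i < n \<Longrightarrow> j < n \<Longrightarrow> 0 \<le> b i j"
      "\<And>i. i < n \<Longrightarrow> q ^ p * v i \<le> (\<Sum>j<n. b i j * v j)" using powers[of p] by blast
    have "b k j \<le> c" if "j < n" for j
    proof -
      have "norm ((B ^\<^sub>m p) $$ (k, j)) \<le> c"
        using c[of p] k that carrier_matD[OF pow_carrier_mat[OF B, of p]]
        unfolding norm_bound_def by metis
      then show ?thesis using b(1,2) k that by simp
    qed
    then have "(\<Sum>j<n. b k j * v j) \<le> C"
      unfolding C_def using v by (intro sum_mono mult_right_mono) auto
    then show ?thesis using b(3)[of k] k by simp
  qed
  obtain p where "C / v k < q ^ p" using real_arch_pow[OF q] by blast
  then have "C < q ^ p * v k" using k by (simp add: divide_less_eq)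
  moreover have "q ^ p * v k \<le> C" by (rule bounded)
  ultimately show False by simp
qed

section \<open>The folded partition of an interval\<close>

locale uniform_grid =
  fixes N :: nat and a :: "nat \<Rightarrow> real"
  assumes two_le_N: "2 \<le> N"
    and width_pos: "a 0 < a N"
    and step: "i \<in> {1..N} \<Longrightarrow> a i - a (i - 1) = (a N - a 0) / N"
begin

lemma N_pos: "0 < N"
  using two_le_N by simp

lemma grid_point: "i \<le> N \<Longrightarrow> a i = a 0 + (a N - a 0) / N * i"
proof (induction i)
  case (Suc i)
  then show ?case using step[of "Suc i"] by (simp add: algebra_simps add_divide_distrib diff_divide_distrib)
qed simp

text \<open>On the scale where the grid becomes \<open>0, \<dots>, N\<close> and \<open>\<tau>\<close> runs through the unit interval,
  \<open>u\<^sub>i\<close> is \<open>\<tau> \<mapsto> i - 1 + \<tau>\<close> or \<open>\<tau> \<mapsto> i - \<tau>\<close>.\<close>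

lemma fold_map_eq:
  assumes "i \<in> {1..N}"
  shows "fold_map N a i t = a 0 + (a N - a 0) / N *
    (if odd i then real i - 1 + (t - a 0) / (a N - a 0) else real i - (t - a 0) / (a N - a 0))"
proof -
  have 1: "a (i - 1) = a 0 + (a N - a 0) / N * (real i - 1)" "a i = a 0 + (a N - a 0) / N * i"
    using grid_point[of i] grid_point[of "i - 1"] assms by (auto simp: of_nat_diff)
  have 2: "a i - a (i - 1) = (a N - a 0) / N"
    using step assms by simp
  then have 3: "a (i - 1) - a i = - ((a N - a 0) / N)" by simp
  have "fold_map N a i t = (if odd i
      then a 0 + (a N - a 0) / N * (real i - 1) + (a N - a 0) / N * ((t - a 0) / (a N - a 0))
      else a 0 + (a N - a 0) / N * i + - ((a N - a 0) / N) * ((t - a 0) / (a N - a 0)))"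
    unfolding fold_map_def 2 3 unfolding 1 times_divide_eq_right[symmetric] ..
  also have "\<dots> = a 0 + (a N - a 0) / N *
    (if odd i then real i - 1 + (t - a 0) / (a N - a 0) else real i - (t - a 0) / (a N - a 0))"
  proof -
    define c \<tau> where "c = (a N - a 0) / N" and "\<tau> = (t - a 0) / (a N - a 0)"
    show ?thesis unfolding c_def[symmetric] \<tau>_def[symmetric] by (simp add: algebra_simps)
  qed
  finally show ?thesis .
qed

lemma unit_param:
  assumes "t \<in> {a 0..a N}"
  obtains \<tau> where "0 \<le> \<tau>" "\<tau> \<le> 1" "(t - a 0) / (a N - a 0) = \<tau>"
    "t = a 0 + (a N - a 0) * \<tau>"
  using assms width_pos that[of "(t - a 0) / (a N - a 0)"] by (auto simp: field_simps)

lemma fold_map_range: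
  assumes "i \<in> {1..N}" "t \<in> {a 0..a N}"
  shows "fold_map N a i t \<in> {a 0..a N}"
proof -
  obtain \<tau> where \<tau>: "0 \<le> \<tau>" "\<tau> \<le> 1" "(t - a 0) / (a N - a 0) = \<tau>"
    using unit_param[OF assms(2)] .
  define e where "e = (if odd i then real i - 1 + \<tau> else real i - \<tau>)"
  have "0 \<le> e" "e \<le> N" using \<tau> assms(1) by (auto simp: e_def)
  then have "0 \<le> (a N - a 0) / N * e" "(a N - a 0) / N * e \<le> (a N - a 0) / N * N"
    using width_pos by (intro mult_nonneg_nonneg mult_left_mono; simp)+
  then show ?thesis
    unfolding fold_map_eq[OF assms(1)] \<tau>(3) e_def[symmetric] using N_pos by simp
qed

lemma fold_map_interior:
  assumes "i \<in> {1..N}" "t \<in> {a 0<..<a N}"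
  shows "fold_map N a i t \<in> {a 0<..<a N}"
proof -
  define \<tau> where "\<tau> = (t - a 0) / (a N - a 0)"
  have \<tau>: "0 < \<tau>" "\<tau> < 1" using assms(2) by (auto simp: \<tau>_def)
  define e where "e = (if odd i then real i - 1 + \<tau> else real i - \<tau>)"
  have "0 < e" "e < N" using \<tau> assms(1) by (auto simp: e_def)
  then have "0 < (a N - a 0) / N * e" "(a N - a 0) / N * e < (a N - a 0) / N * N"
    using width_pos N_pos by (intro mult_pos_pos mult_strict_left_mono; simp)+
  then show ?thesis
    unfolding fold_map_eq[OF assms(1)] \<tau>_def[symmetric] e_def[symmetric] using N_pos by simp
qed

lemma fold_map_endpoint:
  assumes "i \<in> {1..N}" "t \<in> {a 0..a N}" "fold_map N a i t \<in> {a 0, a N}"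
  shows "t \<in> {a 0, a N}"
proof (rule ccontr)
  assume "t \<notin> {a 0, a N}"
  then have "t \<in> {a 0<..<a N}" using assms(2) by auto
  from fold_map_interior[OF assms(1) this]
  have "fold_map N a i t \<noteq> a 0 \<and> fold_map N a i t \<noteq> a N"
    unfolding greaterThanLessThan_iff using less_irrefl by metis
  then show False using assms(3) by blast
qed

text \<open>Neighbouring pieces are folded onto each other, so a point of the interval is reached
  from one preimage only, and it is reached through two different maps only if it is an
  interior grid point and its preimage is an end point.\<close>

lemma fold_map_same_image:
  assumes ij: "i \<in> {1..N}" "j \<in> {1..N}" and st: "s \<in> {a 0..a N}" "t \<in> {a 0..a N}"
    and eq: "fold_map N a i s = fold_map N a j t"
  shows "s = t" and "i \<noteq> j \<Longrightarrow> s \<in> {a 0, a N} \<and> fold_map N a i s \<in> {a 0<..<a N}"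
proof -
  have lt: "s = t \<and> s \<in> {a 0, a N} \<and> fold_map N a i s \<in> {a 0<..<a N}"
    if ij: "i \<in> {1..N}" "j \<in> {1..N}" and st: "s \<in> {a 0..a N}" "t \<in> {a 0..a N}"
      and eq: "fold_map N a i s = fold_map N a j t" and less: "i < j" for i j s t
  proof -
    obtain \<sigma> where \<sigma>: "0 \<le> \<sigma>" "\<sigma> \<le> 1" "(s - a 0) / (a N - a 0) = \<sigma>"
      "s = a 0 + (a N - a 0) * \<sigma>" using unit_param[OF st(1)] .
    obtain \<tau> where \<tau>: "0 \<le> \<tau>" "\<tau> \<le> 1" "(t - a 0) / (a N - a 0) = \<tau>"
      "t = a 0 + (a N - a 0) * \<tau>" using unit_param[OF st(2)] .
    define e where "e = (if odd i then real i - 1 + \<sigma> else real i - \<sigma>)"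
    define d where "d = (if odd j then real j - 1 + \<tau> else real j - \<tau>)"
    have "e = d"
      using eq width_pos N_pos
      unfolding fold_map_eq[OF ij(1)] fold_map_eq[OF ij(2)] \<sigma>(3) \<tau>(3) e_def[symmetric] d_def[symmetric]
      by simp
    have "e \<le> i" using \<sigma> by (auto simp: e_def)
    have "real j - 1 \<le> d" using \<tau> by (auto simp: d_def)
    have "real i \<le> real j - 1" using less by linarith
    have ei: "e = i" and j: "real j = real i + 1"
      using \<open>e = d\<close> \<open>e \<le> i\<close> \<open>real j - 1 \<le> d\<close> \<open>real i \<le> real j - 1\<close> by linarith+
    have j': "j = Suc i" using j by linarith
    have di: "d = i" using \<open>e = d\<close> ei by simp
    have eqs: "\<sigma> = \<tau> \<and> (\<sigma> = 0 \<or> \<sigma> = 1)"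
    proof (cases "odd i")
      case True
      then show ?thesis using ei di by (auto simp: e_def d_def j')
    next
      case False
      then show ?thesis using ei di by (auto simp: e_def d_def j')
    qed
    have "0 < i" "i < N" using ij less by auto
    then have "0 < (a N - a 0) / N * i" "(a N - a 0) / N * i < (a N - a 0) / N * N"
      using width_pos by (intro mult_pos_pos mult_strict_left_mono; simp)+
    then have "fold_map N a i s \<in> {a 0<..<a N}"
      unfolding fold_map_eq[OF ij(1)] \<sigma>(3) e_def[symmetric] ei using N_pos by simp
    then show ?thesis using eqs \<sigma>(4) \<tau>(4) by auto
  qed
  have same: "s = t" if "i = j"
    using eq that width_pos N_pos unfolding that fold_map_eq[OF ij(2)] by (auto split: if_splits)
  show "s = t"
  proof (cases i j rule: linorder_cases)
    case less
    from lt[OF ij st eq this] show ?thesis by blast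
  next
    case greater
    from lt[OF ij(2,1) st(2,1) eq[symmetric] this] show ?thesis by blast
  qed (rule same)
  show "s \<in> {a 0, a N} \<and> fold_map N a i s \<in> {a 0<..<a N}" if "i \<noteq> j"
  proof (cases "i < j")
    case True
    then show ?thesis using lt[OF ij st eq] by blast
  next
    case False
    then have "j < i" using that by simp
    from lt[OF ij(2,1) st(2,1) eq[symmetric] this]
    show ?thesis unfolding eq by (elim conjE) simp
  qed
qed

lemma continuous_on_fold_map: "continuous_on X (fold_map N a i)"
  unfolding fold_map_def using width_pos by (cases "odd i") (auto intro!: continuous_intros)

end

definition fold_word :: "nat \<Rightarrow> (nat \<Rightarrow> real) \<Rightarrow> nat list \<Rightarrow> real \<Rightarrow> real" where
  "fold_word N a is = foldr (\<lambda>i F. fold_map N a i \<circ> F) is id"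

text \<open>The intervals of generation \<open>p\<close> are numbered from left to right by \<open>0, \<dots>, N\<^sup>p - 1\<close>.
  An even letter reverses the order of the intervals inside its piece.\<close>

fun cell_index :: "nat \<Rightarrow> nat list \<Rightarrow> nat" where
  "cell_index N [] = 0"
| "cell_index N (i # is) =
     (if odd i then (i - 1) * N ^ length is + cell_index N is
      else i * N ^ length is - Suc (cell_index N is))"

lemma cell_index_bounds:
  assumes "set (i # is) \<subseteq> {1..N}"
  shows "cell_index N is < N ^ length is"
    and "(i - 1) * N ^ length is \<le> cell_index N (i # is)"
    and "cell_index N (i # is) < i * N ^ length is"
proof -
  have less: "cell_index N is < N ^ length is" if "set is \<subseteq> {1..N}" for "is"
    using that
  proof (induction "is")
    case (Cons i "is")
    then have IH: "cell_index N is < N ^ length is" and i: "1 \<le> i" "i \<le> N" by auto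
    have "Suc (i - 1) * N ^ length is \<le> N * N ^ length is" using i by (intro mult_le_mono) auto
    moreover have "i * N ^ length is - Suc (cell_index N is) < i * N ^ length is"
      using i IH by (intro diff_less) auto
    moreover have "i * N ^ length is \<le> N * N ^ length is" using i by simp
    ultimately show ?case
      using IH unfolding cell_index.simps length_Cons power_Suc mult_Suc
      by (simp only: split: if_split) (intro conjI impI; linarith)
  qed simp
  show l: "cell_index N is < N ^ length is" using less assms by simp
  have i: "1 \<le> i" using assms by simp
  then have *: "i * N ^ length is = (i - 1) * N ^ length is + N ^ length is"
    by (cases i) auto
  show "(i - 1) * N ^ length is \<le> cell_index N (i # is)"
    using l * by (cases "odd i"; simp; linarith)
  show "cell_index N (i # is) < i * N ^ length is"
    using l * by (cases "odd i"; simp; linarith)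
qed

lemma cell_index_inj:
  assumes "set is \<subseteq> {1..N}" "set js \<subseteq> {1..N}" "length is = length js"
    "cell_index N is = cell_index N js"
  shows "is = js"
  using assms(3,1,2,4)
proof (induction "is" js rule: list_induct2)
  case (Cons i "is" j js)
  let ?P = "N ^ length is"
  note bi = cell_index_bounds[OF Cons.prems(1)] and bj = cell_index_bounds[OF Cons.prems(2)]
  have ij: "i = j"
  proof (rule ccontr)
    assume "i \<noteq> j"
    then consider "i \<le> j - 1" | "j \<le> i - 1" by linarith
    then show False
    proof cases
      case 1
      then have "i * ?P \<le> (j - 1) * ?P" by (rule mult_le_mono1)
      then show False using bi(3) bj(2) Cons.prems(3) unfolding Cons.hyps by linarith
    next
      case 2
      then have "j * ?P \<le> (i - 1) * ?P" by (rule mult_le_mono1)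
      then show False using bj(3) bi(2) Cons.prems(3) unfolding Cons.hyps by linarith
    qed
  qed
  have "?P \<le> i * ?P" using Cons.prems(1) by simp
  then have P: "?P \<le> j * ?P" by (simp only: ij)
  have "cell_index N is = cell_index N js"
  proof (cases "odd j")
    case True
    then show ?thesis using Cons.prems(3) Cons.hyps ij by simp
  next
    case False
    then have "j * ?P - Suc (cell_index N is) = j * ?P - Suc (cell_index N js)"
      using Cons.prems(3) Cons.hyps ij by simp
    then show ?thesis using P bi(1) bj(1) unfolding Cons.hyps by linarith
  qed
  then show ?case using Cons ij by simp
qed simp

context uniform_grid
begin

lemma fold_word_Cons: "fold_word N a (i # is) t = fold_map N a i (fold_word N a is t)"
  by (simp add: fold_word_def)

lemma fold_word_interval:
  assumes "set is \<subseteq> {1..N}" "t \<in> {a 0..a N}"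
  shows "\<exists>\<theta>\<in>{0..1::real}. fold_word N a is t =
    a 0 + (a N - a 0) / real N ^ length is * (real (cell_index N is) + \<theta>)"
  using assms(1)
proof (induction "is")
  case Nil
  obtain \<tau> where "0 \<le> \<tau>" "\<tau> \<le> 1" "t = a 0 + (a N - a 0) * \<tau>"
    using unit_param[OF assms(2)] .
  then show ?case by (intro bexI[of _ \<tau>]) (auto simp: fold_word_def)
next
  case (Cons i "is")
  then obtain \<theta> where \<theta>: "0 \<le> \<theta>" "\<theta> \<le> 1"
    "fold_word N a is t = a 0 + (a N - a 0) / real N ^ length is * (real (cell_index N is) + \<theta>)" by auto
  have i: "i \<in> {1..N}" using Cons.prems by simp
  have \<tau>: "(fold_word N a is t - a 0) / (a N - a 0) = (real (cell_index N is) + \<theta>) / real N ^ length is"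
    using width_pos by (simp add: \<theta>(3))
  have P: "real N ^ length is > 0" using N_pos by simp
  show ?case
  proof (cases "odd i")
    case True
    have "fold_word N a (i # is) t =
      a 0 + (a N - a 0) / N * (real i - 1 + (real (cell_index N is) + \<theta>) / real N ^ length is)"
      unfolding fold_word_Cons fold_map_eq[OF i] \<tau> using True by simp
    also have "\<dots> = a 0 + (a N - a 0) / real N ^ length (i # is) * (real (cell_index N (i # is)) + \<theta>)"
      using True i P N_pos by (simp add: of_nat_diff field_simps)
    finally show ?thesis using \<theta> by (intro bexI[of _ \<theta>]) auto
  next
    case False
    have le: "Suc (cell_index N is) \<le> i * N ^ length is"
      using cell_index_bounds(1)[OF Cons.prems] i
      by (metis One_nat_def Suc_leI atLeastAtMost_iff le_trans mult_le_mono1 nat_mult_1)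
    have "fold_word N a (i # is) t =
      a 0 + (a N - a 0) / N * (real i - (real (cell_index N is) + \<theta>) / real N ^ length is)"
      unfolding fold_word_Cons fold_map_eq[OF i] \<tau> using False by simp
    also have "real i - (real (cell_index N is) + \<theta>) / real N ^ length is
        = (real (cell_index N (i # is)) + (1 - \<theta>)) / real N ^ length is"
      using False le P by (simp add: of_nat_diff field_simps)
    finally show ?thesis using \<theta> by (intro bexI[of _ "1 - \<theta>"]) auto
  qed
qed

end

section \<open>Oscillation and mesh cubes\<close>

lemma osc_attained:
  fixes f :: "'a::metric_space \<Rightarrow> real"
  assumes "compact K" "K \<noteq> {}" "continuous_on K f"
  obtains s t where "s \<in> K" "t \<in> K" "osc f K = f s - f t"
    "\<And>u. u \<in> K \<Longrightarrow> f t \<le> f u \<and> f u \<le> f s"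
proof -
  obtain s where s: "s \<in> K" "\<And>u. u \<in> K \<Longrightarrow> f u \<le> f s"
    using continuous_attains_sup[OF assms] by blast
  obtain t where t: "t \<in> K" "\<And>u. u \<in> K \<Longrightarrow> f t \<le> f u"
    using continuous_attains_inf[OF assms] by blast
  have "osc f K = f s - f t"
    unfolding osc_def
  proof (rule cSup_eq_maximum)
    show "f s - f t \<in> (\<lambda>(s, t). f s - f t) ` (K \<times> K)" using s t by force
    fix d assume "d \<in> (\<lambda>(s, t). f s - f t) ` (K \<times> K)"
    then obtain u v where "u \<in> K" "v \<in> K" "d = f u - f v" by auto
    then show "d \<le> f s - f t" using s(2)[of u] t(2)[of v] by simp
  qed
  then show thesis using that[of s t] s t by blast
qed

lemma osc_nonneg:
  fixes f :: "'a::metric_space \<Rightarrow> real"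
  assumes "compact K" "K \<noteq> {}" "continuous_on K f"
  shows "0 \<le> osc f K"
proof -
  obtain s t where "s \<in> K" "t \<in> K" "osc f K = f s - f t"
    "\<And>u. u \<in> K \<Longrightarrow> f t \<le> f u \<and> f u \<le> f s" using osc_attained[OF assms] by blast
  then show ?thesis by auto
qed

text \<open>By the intermediate value theorem a continuous function meets every horizontal layer
  between its minimum and its maximum.\<close>

lemma card_layers_ge:
  fixes f :: "'a::metric_space \<Rightarrow> real"
  assumes K: "compact K" "K \<noteq> {}" "continuous_on K f" "connected K" and eps: "0 < \<epsilon>"
  shows "finite ((\<lambda>t. \<lfloor>f t / \<epsilon>\<rfloor>) ` K)"
    and "max 1 (osc f K / \<epsilon>) \<le> card ((\<lambda>t. \<lfloor>f t / \<epsilon>\<rfloor>) ` K)"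
proof -
  obtain s t where st: "s \<in> K" "t \<in> K" "osc f K = f s - f t"
    "\<And>u. u \<in> K \<Longrightarrow> f t \<le> f u \<and> f u \<le> f s" using osc_attained[OF K(1-3)] by blast
  have "(\<lambda>t. \<lfloor>f t / \<epsilon>\<rfloor>) ` K = {\<lfloor>f t / \<epsilon>\<rfloor>..\<lfloor>f s / \<epsilon>\<rfloor>}"
  proof (intro equalityI subsetI)
    fix m assume "m \<in> {\<lfloor>f t / \<epsilon>\<rfloor>..\<lfloor>f s / \<epsilon>\<rfloor>}"
    then have m: "\<lfloor>f t / \<epsilon>\<rfloor> \<le> m" "m \<le> \<lfloor>f s / \<epsilon>\<rfloor>" by auto
    show "m \<in> (\<lambda>t. \<lfloor>f t / \<epsilon>\<rfloor>) ` K"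
    proof (cases "m = \<lfloor>f t / \<epsilon>\<rfloor>")
      case True
      then show ?thesis using st by blast
    next
      case False
      then have "f t / \<epsilon> < of_int m" "of_int m \<le> f s / \<epsilon>" using m by linarith+
      then have "f t \<le> of_int m * \<epsilon>" "of_int m * \<epsilon> \<le> f s"
        using eps by (auto simp: field_simps)
      moreover have "connected (f ` K)" by (rule connected_continuous_image[OF K(3,4)])
      ultimately have "of_int m * \<epsilon> \<in> f ` K"
        using st unfolding connected_iff_interval by blast
      then obtain u where "u \<in> K" "f u = of_int m * \<epsilon>" by auto
      then show ?thesis using eps by (intro image_eqI[of _ _ u]) auto
    qed
  next
    fix m assume "m \<in> (\<lambda>t. \<lfloor>f t / \<epsilon>\<rfloor>) ` K"
    then show "m \<in> {\<lfloor>f t / \<epsilon>\<rfloor>..\<lfloor>f s / \<epsilon>\<rfloor>}"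
      using st(4) eps by (auto intro!: floor_mono divide_right_mono)
  qed
  moreover have "f t / \<epsilon> \<le> f s / \<epsilon>" using st eps by (auto intro!: divide_right_mono)
  then have "\<lfloor>f t / \<epsilon>\<rfloor> \<le> \<lfloor>f s / \<epsilon>\<rfloor>" by (rule floor_mono)
  moreover have "osc f K / \<epsilon> = f s / \<epsilon> - f t / \<epsilon>" by (simp add: st(3) diff_divide_distrib)
  ultimately show "finite ((\<lambda>t. \<lfloor>f t / \<epsilon>\<rfloor>) ` K)"
    and "max 1 (osc f K / \<epsilon>) \<le> card ((\<lambda>t. \<lfloor>f t / \<epsilon>\<rfloor>) ` K)"
    by (simp_all, linarith)
qed

definition cube_of :: "real \<Rightarrow> ('a::euclidean_space \<Rightarrow> int) \<Rightarrow> 'a set" where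
  "cube_of \<epsilon> n = cbox (\<Sum>b\<in>Basis. (real_of_int (n b) * \<epsilon>) *\<^sub>R b)
                      (\<Sum>b\<in>Basis. ((real_of_int (n b) + 1) * \<epsilon>) *\<^sub>R b)"

lemma mem_cube_of:
  "p \<in> cube_of \<epsilon> n \<longleftrightarrow>
    (\<forall>b\<in>Basis. real_of_int (n b) * \<epsilon> \<le> p \<bullet> b \<and> p \<bullet> b \<le> (real_of_int (n b) + 1) * \<epsilon>)"
  by (auto simp: cube_of_def mem_box inner_sum_left_Basis)

lemma cube_of_cong: "(\<And>b. b \<in> Basis \<Longrightarrow> n b = n' b) \<Longrightarrow> cube_of \<epsilon> n = cube_of \<epsilon> n'"
  by (simp add: cube_of_def)

text \<open>The corner of least coordinates determines a cube.\<close>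

lemma cube_of_inj:
  assumes eps: "0 < \<epsilon>" and eq: "cube_of \<epsilon> n = cube_of \<epsilon> n'" and b: "b \<in> Basis"
  shows "n b = n' b"
proof -
  have le: "n' b \<le> n b" if "cube_of \<epsilon> n = cube_of \<epsilon> n'" for n n' :: "'a \<Rightarrow> int"
  proof -
    have "(\<Sum>b\<in>Basis. (real_of_int (n b) * \<epsilon>) *\<^sub>R b) \<in> cube_of \<epsilon> n"
      unfolding mem_cube_of using eps by (auto simp: inner_sum_left_Basis)
    then have "real_of_int (n' b) * \<epsilon> \<le> real_of_int (n b) * \<epsilon>"
      unfolding that unfolding mem_cube_of using b
      by (auto simp: inner_sum_left_Basis)
    then show ?thesis using eps by simp
  qed
  show ?thesis using le[OF eq] le[OF eq[symmetric]] by simp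
qed

lemma finite_mesh_cubes_meeting:
  fixes E :: "'a::euclidean_space set"
  assumes E: "bounded E" and eps: "0 < \<epsilon>"
  shows "finite {Q \<in> mesh_cubes \<epsilon>. Q \<inter> E \<noteq> {}}"
proof -
  obtain B where B: "\<And>p. p \<in> E \<Longrightarrow> norm p \<le> B" using E by (auto simp: bounded_iff)
  define M where "M = \<lceil>B / \<epsilon>\<rceil> + 1"
  have "{Q \<in> mesh_cubes \<epsilon>. Q \<inter> E \<noteq> {}} \<subseteq> cube_of \<epsilon> ` (Basis \<rightarrow>\<^sub>E {-M..M})"
  proof
    fix Q assume "Q \<in> {Q \<in> mesh_cubes \<epsilon>. Q \<inter> E \<noteq> {}}"
    then obtain n p where n: "Q = cube_of \<epsilon> n" and p: "p \<in> Q" "p \<in> E"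
      by (auto simp: mesh_cubes_def cube_of_def)
    have "n b \<in> {-M..M}" if b: "b \<in> Basis" for b
    proof -
      have "\<bar>p \<bullet> b\<bar> \<le> B" using Basis_le_norm[OF b, of p] B[OF p(2)] by simp
      moreover have "real_of_int (n b) * \<epsilon> \<le> p \<bullet> b" "p \<bullet> b \<le> (real_of_int (n b) + 1) * \<epsilon>"
        using p(1) b unfolding n mem_cube_of by auto
      ultimately have "real_of_int (n b) * \<epsilon> \<le> B" "- B \<le> (real_of_int (n b) + 1) * \<epsilon>" by linarith+
      then have "real_of_int (n b) \<le> B / \<epsilon>" "- (B / \<epsilon>) \<le> real_of_int (n b) + 1"
        using eps by (auto simp: field_simps)
      then show ?thesis unfolding M_def by (simp, linarith)
    qed
    then have "restrict n Basis \<in> Basis \<rightarrow>\<^sub>E {-M..M}" by auto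
    moreover have "Q = cube_of \<epsilon> (restrict n Basis)"
      unfolding n by (rule cube_of_cong) simp
    ultimately show "Q \<in> cube_of \<epsilon> ` (Basis \<rightarrow>\<^sub>E {-M..M})" by blast
  qed
  then show ?thesis by (rule finite_subset) (intro finite_imageI finite_PiE, auto)
qed

definition mesh_index :: "real \<Rightarrow> real \<times> real \<times> real \<Rightarrow> int \<times> int \<times> int" where
  "mesh_index \<epsilon> p = (\<lfloor>fst p / \<epsilon>\<rfloor>, \<lfloor>fst (snd p) / \<epsilon>\<rfloor>, \<lfloor>snd (snd p) / \<epsilon>\<rfloor>)"

text \<open>With half-open cubes every point has a unique cube, which makes counting easy. A half-open
  cube that meets the set lies in a closed one that does, and different half-open cubes lie in
  different closed ones.\<close>

lemma card_mesh_index_le: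
  assumes E: "bounded E" and eps: "0 < \<epsilon>"
  shows "finite (mesh_index \<epsilon> ` E)" and "card (mesh_index \<epsilon> ` E) \<le> mesh_count E \<epsilon>"
proof -
  \<comment> \<open>The three basis vectors pick out the three entries; \<open>(0, 0, 1)\<close> is the last case.\<close>
  define n :: "int \<times> int \<times> int \<Rightarrow> real \<times> real \<times> real \<Rightarrow> int" where
    "n = (\<lambda>(k, l, m) b. if b = (1, 0, 0) then k else if b = (0, 1, 0) then l else m)"
  have Basis: "(Basis :: (real \<times> real \<times> real) set) = {(1, 0, 0), (0, 1, 0), (0, 0, 1)}"
    by (auto simp: Basis_prod_def zero_prod_def)
  have inj: "inj (\<lambda>c. cube_of \<epsilon> (n c))"
  proof (rule injI)
    fix c c' assume "cube_of \<epsilon> (n c) = cube_of \<epsilon> (n c')"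
    then have "n c b = n c' b" if "b \<in> Basis" for b
      using cube_of_inj[OF eps] that by blast
    then have "n c (1, 0, 0) = n c' (1, 0, 0)" "n c (0, 1, 0) = n c' (0, 1, 0)"
      "n c (0, 0, 1) = n c' (0, 0, 1)" unfolding Basis by blast+
    then show "c = c'" by (cases c, cases c') (simp add: n_def)
  qed
  have sub: "(\<lambda>c. cube_of \<epsilon> (n c)) ` mesh_index \<epsilon> ` E \<subseteq> {Q \<in> mesh_cubes \<epsilon>. Q \<inter> E \<noteq> {}}"
  proof (intro subsetI, elim imageE)
    fix Q c p assume Q: "Q = cube_of \<epsilon> (n c)" "c = mesh_index \<epsilon> p" and p: "p \<in> E"
    have fl: "real_of_int \<lfloor>r / \<epsilon>\<rfloor> * \<epsilon> \<le> r \<and> r \<le> (real_of_int \<lfloor>r / \<epsilon>\<rfloor> + 1) * \<epsilon>" for r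
      using floor_divide_lower[OF eps, of r] floor_divide_upper[OF eps, of r] by simp
    have "p \<in> Q"
      unfolding Q mem_cube_of Basis
      using fl by (cases p) (auto simp: n_def mesh_index_def)
    then show "Q \<in> {Q \<in> mesh_cubes \<epsilon>. Q \<inter> E \<noteq> {}}"
      using p unfolding Q by (auto simp: mesh_cubes_def cube_of_def)
  qed
  have "finite ((\<lambda>c. cube_of \<epsilon> (n c)) ` mesh_index \<epsilon> ` E)"
    using sub finite_mesh_cubes_meeting[OF E eps] by (rule finite_subset)
  then show "finite (mesh_index \<epsilon> ` E)"
    using inj by (metis finite_imageD inj_on_subset subset_UNIV)
  have "card (mesh_index \<epsilon> ` E) = card ((\<lambda>c. cube_of \<epsilon> (n c)) ` mesh_index \<epsilon> ` E)"
    using inj by (metis card_image inj_on_subset subset_UNIV)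
  also have "\<dots> \<le> mesh_count E \<epsilon>"
    unfolding mesh_count_def using sub finite_mesh_cubes_meeting[OF E eps] by (intro card_mono) auto
  finally show "card (mesh_index \<epsilon> ` E) \<le> mesh_count E \<epsilon>" .
qed

text \<open>The scales \<open>A / N\<^sup>p\<close> are dense enough: between two consecutive ones the logarithms
  change by a bounded amount only.\<close>

lemma lower_box_dim_ge:
  fixes E :: "'a::euclidean_space set" and N :: nat and A c R :: real
  assumes N: "2 \<le> N" and A: "0 < A" and c: "0 < c" and R: "1 \<le> R"
    and count: "\<And>p \<epsilon>. p0 \<le> p \<Longrightarrow> 0 < \<epsilon> \<Longrightarrow> \<epsilon> \<le> A / real N ^ p \<Longrightarrow> c * R ^ p \<le> mesh_count E \<epsilon>"
  shows "ereal (ln R / ln N) \<le> lower_box_dim E"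
proof -
  define d where "d = ln R / ln N"
  define C where "C = ln c + (ln A / ln N - 1) * ln R"
  have lnN: "0 < ln (real N)" using N by simp
  define \<epsilon>0 where "\<epsilon>0 = min (A / real N ^ p0) 1"
  have \<epsilon>0: "0 < \<epsilon>0" using A N by (simp add: \<epsilon>0_def)
  have bound: "d + C / ln (1 / \<epsilon>) \<le> ln (mesh_count E \<epsilon>) / ln (1 / \<epsilon>)"
    if e: "0 < \<epsilon>" "\<epsilon> < \<epsilon>0" for \<epsilon>
  proof -
    have e1: "\<epsilon> < 1" "\<epsilon> \<le> A / real N ^ p0" using e by (auto simp: \<epsilon>0_def)
    define l where "l = log N (A / \<epsilon>)"
    define p where "p = nat \<lfloor>l\<rfloor>"
    have "real N ^ p0 \<le> A / \<epsilon>" using e1(2) e N by (simp add: field_simps)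
    then have "real p0 \<le> l"
      using N e A by (simp add: l_def le_log_iff powr_realpow)
    then have p: "p0 \<le> p" "real p \<le> l" "l - 1 \<le> real p" unfolding p_def by linarith+
    have "real N ^ p \<le> A / \<epsilon>"
      using p(2) N e A by (simp add: l_def le_log_iff powr_realpow)
    then have "\<epsilon> \<le> A / real N ^ p" using e N by (simp add: field_simps)
    then have "c * R ^ p \<le> mesh_count E \<epsilon>" using count p(1) e(1) by blast
    moreover have "0 < c * R ^ p" using c R by simp
    ultimately have "ln (c * R ^ p) \<le> ln (mesh_count E \<epsilon>)" by simp
    moreover have "ln (c * R ^ p) = ln c + p * ln R"
      using c R by (simp add: ln_mult ln_realpow)
    moreover have "(l - 1) * ln R \<le> p * ln R" using p R by (intro mult_right_mono) auto
    moreover have "l = ln A / ln N + ln (1 / \<epsilon>) / ln N"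
      using A e by (simp add: l_def log_def ln_div diff_divide_distrib)
    then have "ln c + (l - 1) * ln R = C + d * ln (1 / \<epsilon>)"
      by (simp add: C_def d_def algebra_simps)
    ultimately have "C + d * ln (1 / \<epsilon>) \<le> ln (mesh_count E \<epsilon>)" by linarith
    moreover have ln0: "0 < ln (1 / \<epsilon>)" using e e1 by simp
    ultimately have "(C + d * ln (1 / \<epsilon>)) / ln (1 / \<epsilon>) \<le> ln (mesh_count E \<epsilon>) / ln (1 / \<epsilon>)"
      by (intro divide_right_mono) auto
    then show ?thesis using ln0 by (simp add: add_divide_distrib add.commute)
  qed
  have "filterlim (\<lambda>\<epsilon>::real. ln (1 / \<epsilon>)) at_top (at_right 0)"
    by real_asymp
  then have "((\<lambda>\<epsilon>. C / ln (1 / \<epsilon>)) \<longlongrightarrow> 0) (at_right 0)"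
    by (rule real_tendsto_divide_at_top[OF tendsto_const])
  then have "((\<lambda>\<epsilon>. d + C / ln (1 / \<epsilon>)) \<longlongrightarrow> d + 0) (at_right 0)"
    by (intro tendsto_add tendsto_const)
  then have "((\<lambda>\<epsilon>. ereal (d + C / ln (1 / \<epsilon>))) \<longlongrightarrow> ereal d) (at_right 0)"
    by simp
  then have "ereal d = Liminf (at_right 0) (\<lambda>\<epsilon>. ereal (d + C / ln (1 / \<epsilon>)))"
    by (intro lim_imp_Liminf[symmetric] trivial_limit_at_right_real)
  also have "\<dots> \<le> lower_box_dim E"
    unfolding lower_box_dim_def
  proof (rule Liminf_mono)
    show "\<forall>\<^sub>F \<epsilon> in at_right 0. ereal (d + C / ln (1 / \<epsilon>)) \<le> ereal (ln (mesh_count E \<epsilon>) / ln (1 / \<epsilon>))"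
      using bound \<epsilon>0 unfolding eventually_at_right_field by (intro exI[of _ \<epsilon>0]) auto
  qed
  finally show ?thesis by (simp add: d_def)
qed

section \<open>The cells of the folded grid\<close>

locale fold_grid =
  X: uniform_grid N x + Y: uniform_grid N y for N x y +
  assumes same_width: "x N - x 0 = y N - y 0"
begin

definition width :: real where "width = x N - x 0"

lemma width_pos: "0 < width"
  using X.width_pos by (simp add: width_def)

lemma width_alt: "y N - y 0 = width"
  by (simp add: width_def same_width)

lemma N_pos: "0 < real N"
  using X.N_pos by simp

abbreviation D :: "(real \<times> real) set" where "D \<equiv> rect_domain N x y"

lemma mem_D: "t \<in> D \<longleftrightarrow> fst t \<in> {x 0..x N} \<and> snd t \<in> {y 0..y N}"
  by (cases t) (auto simp: rect_domain_def)

lemma mem_letters: "w \<in> letters N \<longleftrightarrow> fst w \<in> {1..N} \<and> snd w \<in> {1..N}"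
  by (cases w) (auto simp: letters_def)

lemma cell_map_in: "w \<in> letters N \<Longrightarrow> t \<in> D \<Longrightarrow> cell_map N x y w t \<in> D"
  unfolding mem_D mem_letters cell_map_def fst_conv snd_conv
  using X.fold_map_range Y.fold_map_range by blast

lemma word_map_Nil: "word_map N x y [] = id"
  by (simp add: word_map_def)

lemma word_map_Cons: "word_map N x y (w # v) = cell_map N x y w \<circ> word_map N x y v"
  by (simp add: word_map_def)

lemma word_map_append: "word_map N x y (u @ v) = word_map N x y u \<circ> word_map N x y v"
  by (induction u) (auto simp: word_map_Nil word_map_Cons)

lemma word_map_eq_fold_word:
  "word_map N x y w t = (fold_word N x (map fst w) (fst t), fold_word N y (map snd w) (snd t))"
  by (induction w) (auto simp: word_map_Nil word_map_Cons cell_map_def fold_word_def)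

lemma word_map_in: "set w \<subseteq> letters N \<Longrightarrow> t \<in> D \<Longrightarrow> word_map N x y w t \<in> D"
  by (induction w) (auto simp: word_map_Nil word_map_Cons cell_map_in)

lemma word_cell_Nil: "word_cell N x y [] = D"
  by (simp add: word_cell_def word_map_Nil)

lemma word_cell_Cons: "word_cell N x y (w # v) = cell_map N x y w ` word_cell N x y v"
  by (simp add: word_cell_def word_map_Cons image_comp)

lemma word_cell_subset: "set w \<subseteq> letters N \<Longrightarrow> word_cell N x y w \<subseteq> D"
  using word_map_in by (auto simp: word_cell_def)

lemma word_cell_append_subset:
  assumes "set v \<subseteq> letters N"
  shows "word_cell N x y (u @ v) \<subseteq> word_cell N x y u"
  using word_map_in[OF assms] by (auto simp: word_cell_def word_map_append)

lemma continuous_on_word_map: "continuous_on X (word_map N x y w)"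
proof (induction w)
  case (Cons w v)
  have "continuous_on Z (cell_map N x y w)" for Z
    unfolding cell_map_def
    by (intro continuous_on_Pair continuous_on_compose2[OF X.continuous_on_fold_map[of UNIV]]
        continuous_on_compose2[OF Y.continuous_on_fold_map[of UNIV]] continuous_intros) auto
  then show ?case unfolding word_map_Cons by (intro continuous_on_compose Cons.IH)
qed (simp add: word_map_Nil)

lemma D_nonempty: "D \<noteq> {}"
  using X.width_pos Y.width_pos by (auto simp: rect_domain_def)

lemma word_cell_topology:
  "compact (word_cell N x y w)" "connected (word_cell N x y w)" "word_cell N x y w \<noteq> {}"
proof -
  have "compact D" "connected D"
    unfolding rect_domain_def
    by (auto intro!: compact_Times connected_Times convex_connected)
  then show "compact (word_cell N x y w)" "connected (word_cell N x y w)" "word_cell N x y w \<noteq> {}"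
    unfolding word_cell_def using D_nonempty
    by (auto intro: compact_continuous_image connected_continuous_image continuous_on_word_map)
qed

lemma word_cell_position:
  assumes w: "w \<in> words N p" and t: "t \<in> word_cell N x y w"
  shows "fst t \<in> {x 0 + width / real N ^ p * cell_index N (map fst w) ..
                  x 0 + width / real N ^ p * (real (cell_index N (map fst w)) + 1)}"
    and "snd t \<in> {y 0 + width / real N ^ p * cell_index N (map snd w) ..
                  y 0 + width / real N ^ p * (real (cell_index N (map snd w)) + 1)}"
proof -
  have len: "length w = p" and set: "set (map fst w) \<subseteq> {1..N}" "set (map snd w) \<subseteq> {1..N}"
    using w by (auto simp: words_def letters_def)
  obtain u where u: "u \<in> D" "t = word_map N x y w u"
    using t by (auto simp: word_cell_def)
  have P: "width / real N ^ p \<ge> 0" using width_pos by simp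
  have le: "b + width / real N ^ p * real k \<le> b + width / real N ^ p * (real k + \<theta>)"
    "b + width / real N ^ p * (real k + \<theta>) \<le> b + width / real N ^ p * (real k + 1)"
    if "\<theta> \<in> {0..1}" for b \<theta> :: real and k :: nat
    using that P by (intro add_left_mono mult_left_mono; simp)+
  obtain \<theta> where "\<theta> \<in> {0..1}" "fst t = x 0 + width / real N ^ p * (real (cell_index N (map fst w)) + \<theta>)"
    using X.fold_word_interval[OF set(1), of "fst u"] u len
    by (auto simp: word_map_eq_fold_word mem_D width_def)
  then show "fst t \<in> {x 0 + width / real N ^ p * cell_index N (map fst w) ..
                  x 0 + width / real N ^ p * (real (cell_index N (map fst w)) + 1)}"
    using le by simp
  obtain \<theta> where "\<theta> \<in> {0..1}" "snd t = y 0 + width / real N ^ p * (real (cell_index N (map snd w)) + \<theta>)"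
    using Y.fold_word_interval[OF set(2), of "snd u"] u len
    by (auto simp: word_map_eq_fold_word mem_D width_alt)
  then show "snd t \<in> {y 0 + width / real N ^ p * cell_index N (map snd w) ..
                  y 0 + width / real N ^ p * (real (cell_index N (map snd w)) + 1)}"
    using le by simp
qed

lemma word_cell_diameter:
  assumes w: "w \<in> words N p" and st: "s \<in> word_cell N x y w" "t \<in> word_cell N x y w"
  shows "dist s t \<le> 2 * width / real N ^ p"
proof -
  have "dist (fst s) (fst t) \<le> width / real N ^ p" "dist (snd s) (snd t) \<le> width / real N ^ p"
    using word_cell_position[OF w st(1)] word_cell_position[OF w st(2)]
    by (auto simp: dist_real_def distrib_left abs_le_iff)
  moreover have "dist s t \<le> dist (fst s) (fst t) + dist (snd s) (snd t)"
    by (cases s, cases t) (auto simp: dist_Pair_Pair intro: sqrt_sum_squares_le_sum)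
  ultimately show ?thesis by simp
qed

lemma finite_words: "finite (words N p)"
  unfolding set_word_list[symmetric] by simp

text \<open>A half-open interval no longer than the mesh of a grid meets at most two of its closed
  intervals, hence a small square meets at most four cells.\<close>

lemma card_words_meeting_column:
  assumes eps: "0 < \<epsilon>" "\<epsilon> \<le> width / real N ^ p"
  shows "card {w \<in> words N p. \<exists>t\<in>word_cell N x y w. \<lfloor>fst t / \<epsilon>\<rfloor> = k \<and> \<lfloor>snd t / \<epsilon>\<rfloor> = l} \<le> 4"
proof -
  let ?W = "{w \<in> words N p. \<exists>t\<in>word_cell N x y w. \<lfloor>fst t / \<epsilon>\<rfloor> = k \<and> \<lfloor>snd t / \<epsilon>\<rfloor> = l}"
  define \<delta> where "\<delta> = width / real N ^ p"
  have \<delta>: "0 < \<delta>" "\<epsilon> \<le> \<delta>" using eps by (auto simp: \<delta>_def)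
  \<comment> \<open>Only the grid intervals number \<open>J\<close> and \<open>J + 1\<close> can meet the mesh interval number \<open>m\<close>.\<close>
  define J where "J b m = \<lceil>(of_int m * \<epsilon> - b) / \<delta>\<rceil> - 1" for b :: real and m :: int
  have J: "int j \<in> {J b m, J b m + 1}"
    if "r \<in> {b + \<delta> * real j..b + \<delta> * (real j + 1)}" "\<lfloor>r / \<epsilon>\<rfloor> = m" for b r j m
  proof -
    have "of_int m \<le> r / \<epsilon>" "r / \<epsilon> < of_int m + 1" using that(2) by linarith+
    then have "of_int m * \<epsilon> \<le> r" "r < of_int m * \<epsilon> + \<epsilon>"
      using eps by (auto simp: field_simps)
    then have "of_int m * \<epsilon> - b \<le> (real j + 1) * \<delta>" "real j * \<delta> < of_int m * \<epsilon> - b + 1 * \<delta>"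
      using that(1) \<delta> by (auto simp: algebra_simps)
    then have "(of_int m * \<epsilon> - b) / \<delta> \<le> real j + 1" "real j < (of_int m * \<epsilon> - b) / \<delta> + 1"
      using \<delta> by (auto simp: field_simps)
    then show ?thesis unfolding J_def by (simp, linarith)
  qed
  let ?c = "\<lambda>w. (int (cell_index N (map fst w)), int (cell_index N (map snd w)))"
  have "inj_on ?c ?W"
  proof (rule inj_onI)
    fix v w assume vw: "v \<in> ?W" "w \<in> ?W" "?c v = ?c w"
    then have sets: "set (map fst v) \<subseteq> {1..N}" "set (map fst w) \<subseteq> {1..N}"
      "set (map snd v) \<subseteq> {1..N}" "set (map snd w) \<subseteq> {1..N}" and len: "length v = length w"
      by (auto simp: words_def letters_def)
    have "map fst v = map fst w" "map snd v = map snd w"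
      using cell_index_inj[OF sets(1,2)] cell_index_inj[OF sets(3,4)] len vw(3) by simp_all
    then show "v = w" by (metis zip_map_fst_snd)
  qed
  moreover have "?c ` ?W \<subseteq> {J (x 0) k, J (x 0) k + 1} \<times> {J (y 0) l, J (y 0) l + 1}"
  proof (intro subsetI, elim imageE)
    fix c w assume c: "c = ?c w" and w: "w \<in> ?W"
    then obtain t where t: "t \<in> word_cell N x y w" "\<lfloor>fst t / \<epsilon>\<rfloor> = k" "\<lfloor>snd t / \<epsilon>\<rfloor> = l" by auto
    have "w \<in> words N p" using w by simp
    from J[OF word_cell_position(1)[OF this t(1), folded \<delta>_def] t(2)]
      J[OF word_cell_position(2)[OF this t(1), folded \<delta>_def] t(3)]
    show "c \<in> {J (x 0) k, J (x 0) k + 1} \<times> {J (y 0) l, J (y 0) l + 1}"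
      unfolding c by blast
  qed
  ultimately have "card ?W \<le> card ({J (x 0) k, J (x 0) k + 1} \<times> {J (y 0) l, J (y 0) l + 1})"
    by (intro card_inj_on_le) auto
  also have "\<dots> \<le> 4" by (simp add: card_cartesian_product)
  finally show ?thesis .
qed

text \<open>Above each cell the graph meets one cube for every layer that \<open>f\<close> meets there, and at most
  four cells share a column of cubes.\<close>

lemma osc_sum_le_mesh_count:
  assumes f: "continuous_on D f" and eps: "0 < \<epsilon>" "\<epsilon> \<le> width / real N ^ p"
  shows "(\<Sum>w\<in>words N p. max 1 (osc f (word_cell N x y w) / \<epsilon>)) \<le> 4 * mesh_count (graph_over D f) \<epsilon>"
proof -
  let ?L = "\<lambda>w. (\<lambda>t. \<lfloor>f t / \<epsilon>\<rfloor>) ` word_cell N x y w"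
  let ?G = "mesh_index \<epsilon> ` graph_over D f"
  let ?W = "\<lambda>k l. {w \<in> words N p. \<exists>t\<in>word_cell N x y w. \<lfloor>fst t / \<epsilon>\<rfloor> = k \<and> \<lfloor>snd t / \<epsilon>\<rfloor> = l}"
  have cellsub: "word_cell N x y w \<subseteq> D" if "w \<in> words N p" for w
    using that word_cell_subset by (auto simp: words_def)
  have layers: "finite (?L w)" "max 1 (osc f (word_cell N x y w) / \<epsilon>) \<le> card (?L w)"
    if "w \<in> words N p" for w
    using card_layers_ge[OF word_cell_topology(1,3) continuous_on_subset[OF f cellsub[OF that]]
        word_cell_topology(2) eps(1)] by auto
  have graph: "graph_over D f = (\<lambda>t. (fst t, snd t, f t)) ` D"
    by (force simp: graph_over_def)
  have "compact (graph_over D f)"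
    unfolding graph using word_cell_topology(1)[of "[]"]
    by (intro compact_continuous_image continuous_intros f) (simp add: word_cell_Nil)
  then have G: "finite ?G" "card ?G \<le> mesh_count (graph_over D f) \<epsilon>"
    using card_mesh_index_le[OF compact_imp_bounded eps(1)] by auto
  have "(\<Sum>w\<in>words N p. max 1 (osc f (word_cell N x y w) / \<epsilon>)) \<le> (\<Sum>w\<in>words N p. real (card (?L w)))"
    by (intro sum_mono layers)
  also have "\<dots> = card (Sigma (words N p) ?L)"
    using layers finite_words by simp
  also have "\<dots> \<le> card (\<Union>c\<in>?G. ?W (fst c) (fst (snd c)) \<times> {snd (snd c)})"
  proof (intro of_nat_mono card_mono)
    show "finite (\<Union>c\<in>?G. ?W (fst c) (fst (snd c)) \<times> {snd (snd c)})"
      by (intro finite_UN_I[OF G(1)] finite_cartesian_product finite_subset[OF _ finite_words]) auto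
    show "Sigma (words N p) ?L \<subseteq> (\<Union>c\<in>?G. ?W (fst c) (fst (snd c)) \<times> {snd (snd c)})"
    proof
      fix wm assume "wm \<in> Sigma (words N p) ?L"
      then obtain w t where w: "w \<in> words N p" and t: "t \<in> word_cell N x y w"
        and wm: "wm = (w, \<lfloor>f t / \<epsilon>\<rfloor>)" by auto
      have "mesh_index \<epsilon> (fst t, snd t, f t) \<in> ?G"
        using cellsub[OF w] t unfolding graph by blast
      then show "wm \<in> (\<Union>c\<in>?G. ?W (fst c) (fst (snd c)) \<times> {snd (snd c)})"
        unfolding wm using w t by (intro UN_I) (auto simp: mesh_index_def)
    qed
  qed
  also have "\<dots> \<le> (\<Sum>c\<in>?G. real (card (?W (fst c) (fst (snd c)) \<times> {snd (snd c)})))"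
    using card_UN_le[OF G(1)] unfolding of_nat_sum[symmetric] by (intro of_nat_mono) blast
  also have "\<dots> \<le> (\<Sum>c\<in>?G. 4)"
    using card_words_meeting_column[OF eps] by (intro sum_mono) (simp add: card_cartesian_product)
  also have "\<dots> \<le> 4 * mesh_count (graph_over D f) \<epsilon>" using G(2) by simp
  finally show ?thesis .
qed

end

section \<open>The vertical scaling matrices\<close>

lemma bij_betw_word_list: "bij_betw ((!) (word_list N n)) {..<length (word_list N n)} (words N n)"
  using bij_betw_nth[OF distinct_word_list refl set_word_list[symmetric]] .

lemma sum_word_list: "(\<Sum>a<length (word_list N n). g (word_list N n ! a)) = (\<Sum>w\<in>words N n. g w)"
  by (rule sum.reindex_bij_betw[OF bij_betw_word_list])

locale scaled_grid = fold_grid N x y for N x y +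
  fixes S :: "real \<times> real \<Rightarrow> real"
  assumes S_less_1: "t \<in> D \<Longrightarrow> \<bar>S t\<bar> < 1"
begin

abbreviation scale :: "(nat \<times> nat) list \<Rightarrow> real" where "scale \<equiv> lower_scale N x y S"
abbreviation radius :: "nat \<Rightarrow> real" where "radius n \<equiv> spectral_radius (lower_matrix N x y S n)"

lemma scale_le: "t \<in> word_cell N x y w \<Longrightarrow> scale w \<le> \<bar>S t\<bar>"
  unfolding lower_scale_def by (rule cINF_lower) (auto intro!: bdd_belowI[of _ 0])

lemma scale_greatest: "(\<And>t. t \<in> word_cell N x y w \<Longrightarrow> c \<le> \<bar>S t\<bar>) \<Longrightarrow> c \<le> scale w"
  unfolding lower_scale_def using word_cell_topology(3) by (rule cINF_greatest)

lemma scale_nonneg: "0 \<le> scale w"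
  by (rule scale_greatest) simp

lemma scale_le_1:
  assumes "set w \<subseteq> letters N"
  shows "scale w \<le> 1"
proof -
  obtain t where t: "t \<in> word_cell N x y w" using word_cell_topology(3) by blast
  then show ?thesis using scale_le[OF t] S_less_1[of t] word_cell_subset[OF assms] by force
qed

lemma scale_append_mono: "set v \<subseteq> letters N \<Longrightarrow> scale u \<le> scale (u @ v)"
  using word_cell_append_subset by (intro scale_greatest scale_le) blast

lemma lower_entry_nonneg: "0 \<le> lower_entry N x y S i j"
  by (simp add: lower_entry_def scale_nonneg)

lemma words_nonempty: "words N n \<noteq> {}"
proof -
  have "replicate n (1, 1) \<in> words N n" using X.N_pos by (auto simp: words_def letters_def)
  then show ?thesis by blast
qed

lemma word_list_pos: "0 < length (word_list N n)"
  using words_nonempty unfolding set_word_list[symmetric] by simp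

lemma lower_matrix_eq:
  "lower_matrix N x y S n = Matrix.mat (length (word_list N n)) (length (word_list N n))
     (\<lambda>(a, b). complex_of_real (lower_entry N x y S (word_list N n ! a) (word_list N n ! b)))"
  by (simp add: lower_matrix_def Let_def)

lemma radius_nonneg: "0 \<le> radius n"
  unfolding lower_matrix_eq by (rule spectral_radius_nonneg[OF _ word_list_pos[of n]]) simp

lemma index_weights:
  obtains l where "\<And>a. a < length (word_list N n) \<Longrightarrow> l (word_list N n ! a) = v a"
proof (rule that[of "v \<circ> inv_into {..<length (word_list N n)} ((!) (word_list N n))"])
  show "(v \<circ> inv_into {..<length (word_list N n)} ((!) (word_list N n))) (word_list N n ! a) = v a"
    if "a < length (word_list N n)" for a
    using that bij_betw_word_list[of N n] by (simp add: bij_betw_def inv_into_f_f)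
qed

lemma words_index:
  assumes "w \<in> words N n"
  obtains a where "a < length (word_list N n)" "w = word_list N n ! a"
  using assms unfolding set_word_list[symmetric] in_set_conv_nth by blast

lemma radius_left_weights:
  obtains l where "\<And>w. w \<in> words N n \<Longrightarrow> 0 \<le> l w" "\<exists>w\<in>words N n. 0 < l w"
    "\<And>j. j \<in> words N n \<Longrightarrow> radius n * l j \<le> (\<Sum>i\<in>words N n. l i * lower_entry N x y S i j)"
proof -
  let ?ws = "word_list N n"
  obtain v where v: "\<And>i. 0 \<le> v i" "\<exists>i<length ?ws. 0 < v i"
    "\<And>j. j < length ?ws \<Longrightarrow> radius n * v j \<le>
      (\<Sum>i<length ?ws. v i * lower_entry N x y S (?ws ! i) (?ws ! j))"
    unfolding lower_matrix_eq
    by (rule left_subeigenvector_exists[of "length ?ws" "\<lambda>a b. lower_entry N x y S (?ws ! a) (?ws ! b)"])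
      (use lower_entry_nonneg word_list_pos in auto)
  obtain l where l: "\<And>a. a < length ?ws \<Longrightarrow> l (?ws ! a) = v a" using index_weights[of n v] by blast
  show thesis
  proof (rule that[of l])
    show "0 \<le> l w" if "w \<in> words N n" for w using words_index[OF that] l v(1) by metis
    show "\<exists>w\<in>words N n. 0 < l w"
      using v(2) l unfolding set_word_list[symmetric] by (metis nth_mem)
    fix j assume "j \<in> words N n"
    then obtain b where b: "b < length ?ws" "j = ?ws ! b" using words_index by blast
    have "radius n * v b \<le> (\<Sum>a<length ?ws. l (?ws ! a) * lower_entry N x y S (?ws ! a) j)"
      using v(3)[OF b(1)] b(2) l by simp
    then show "radius n * l j \<le> (\<Sum>i\<in>words N n. l i * lower_entry N x y S i j)"
      unfolding sum_word_list[of "\<lambda>i. l i * lower_entry N x y S i j"] using b l by simp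
  qed
qed

lemma radius_right_weights:
  obtains l where "\<And>w. w \<in> words N n \<Longrightarrow> 0 \<le> l w" "\<exists>w\<in>words N n. 0 < l w"
    "\<And>i. i \<in> words N n \<Longrightarrow> radius n * l i \<le> (\<Sum>j\<in>words N n. lower_entry N x y S i j * l j)"
proof -
  let ?ws = "word_list N n"
  obtain v where v: "\<And>i. 0 \<le> v i" "\<exists>i<length ?ws. 0 < v i"
    "\<And>i. i < length ?ws \<Longrightarrow> radius n * v i \<le>
      (\<Sum>j<length ?ws. lower_entry N x y S (?ws ! i) (?ws ! j) * v j)"
    unfolding lower_matrix_eq
    by (rule right_subeigenvector_exists[of "length ?ws" "\<lambda>a b. lower_entry N x y S (?ws ! a) (?ws ! b)"])
      (use lower_entry_nonneg word_list_pos in auto)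
  obtain l where l: "\<And>a. a < length ?ws \<Longrightarrow> l (?ws ! a) = v a" using index_weights[of n v] by blast
  show thesis
  proof (rule that[of l])
    show "0 \<le> l w" if "w \<in> words N n" for w using words_index[OF that] l v(1) by metis
    show "\<exists>w\<in>words N n. 0 < l w"
      using v(2) l unfolding set_word_list[symmetric] by (metis nth_mem)
    fix i assume "i \<in> words N n"
    then obtain b where b: "b < length ?ws" "i = ?ws ! b" using words_index by blast
    have "radius n * v b \<le> (\<Sum>a<length ?ws. lower_entry N x y S i (?ws ! a) * l (?ws ! a))"
      using v(3)[OF b(1)] b(2) l by simp
    then show "radius n * l i \<le> (\<Sum>j\<in>words N n. lower_entry N x y S i j * l j)"
      unfolding sum_word_list[of "\<lambda>j. lower_entry N x y S i j * l j"] using b l by simp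
  qed
qed

lemma radius_ge:
  assumes l: "\<And>w. w \<in> words N n \<Longrightarrow> 0 \<le> l w" and k: "k \<in> words N n" "0 < l k"
    and sub: "\<And>i. i \<in> words N n \<Longrightarrow> \<rho> * l i \<le> (\<Sum>j\<in>words N n. lower_entry N x y S i j * l j)"
  shows "\<rho> \<le> radius n"
proof -
  let ?ws = "word_list N n"
  have mem: "?ws ! a \<in> words N n" if "a < length ?ws" for a
    using that unfolding set_word_list[symmetric] by simp
  obtain b where b: "b < length ?ws" "k = ?ws ! b" using words_index[OF k(1)] .
  show ?thesis
    unfolding lower_matrix_eq
  proof (rule spectral_radius_ge_subeigenvector[where v = "\<lambda>a. l (?ws ! a)"])
    show "b < length ?ws" "0 < l (?ws ! b)" using b k by auto
    show "0 \<le> lower_entry N x y S (?ws ! i) (?ws ! j)" for i j by (rule lower_entry_nonneg)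
    show "0 \<le> l (?ws ! a)" if "a < length ?ws" for a using l mem that by blast
    show "\<rho> * l (?ws ! a) \<le> (\<Sum>j<length ?ws. lower_entry N x y S (?ws ! a) (?ws ! j) * l (?ws ! j))"
      if "a < length ?ws" for a
      using sub[OF mem[OF that]]
      unfolding sum_word_list[symmetric, of "\<lambda>j. lower_entry N x y S (?ws ! a) j * l j"] .
  qed
qed

lemma sum_lower_entry:
  assumes i: "i \<in> words N n" and n: "1 \<le> n"
  shows "(\<Sum>j\<in>words N n. lower_entry N x y S i j * l j) = (\<Sum>a\<in>letters N. scale (i @ [a]) * l (tl i @ [a]))"
proof -
  let ?J = "(\<lambda>a. tl i @ [a]) ` letters N"
  have i': "set i \<subseteq> letters N" "length i = n" "i \<noteq> []" using i n by (auto simp: words_def)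
  have J: "?J \<subseteq> words N n"
    using i' n by (auto simp: words_def dest: list.set_sel(2))
  have "(\<Sum>j\<in>words N n. lower_entry N x y S i j * l j) = (\<Sum>j\<in>?J. lower_entry N x y S i j * l j)"
  proof (rule sum.mono_neutral_right[OF finite_words J], intro ballI)
    fix j assume j: "j \<in> words N n - ?J"
    then have "j \<noteq> []" "set j \<subseteq> letters N" using n by (auto simp: words_def)
    then have "last j \<in> letters N" "j = butlast j @ [last j]" by auto
    then have "tl i \<noteq> butlast j" using j by auto
    then show "lower_entry N x y S i j * l j = 0" by (simp add: lower_entry_def)
  qed
  also have "\<dots> = (\<Sum>a\<in>letters N. scale (i @ [a]) * l (tl i @ [a]))"
    by (subst sum.reindex) (auto simp: inj_on_def lower_entry_def)
  finally show ?thesis .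
qed

lemma finite_letters: "finite (letters N)"
  by (simp add: letters_def)

text \<open>A right subeigenvector \<open>v\<close> for words of length \<open>n\<close> is transported to words of length
  \<open>n + 1\<close> by \<open>v' i = s\<^sub>i v (\<sigma> i)\<close>. It is one there because lower scales can only grow when the
  cell shrinks.\<close>

lemma radius_mono:
  assumes n: "1 \<le> n"
  shows "radius n \<le> radius (Suc n)"
proof (cases "radius n = 0")
  case True
  then show ?thesis using radius_nonneg by simp
next
  case False
  then have pos: "0 < radius n" using radius_nonneg[of n] by simp
  obtain v where v: "\<And>w. w \<in> words N n \<Longrightarrow> 0 \<le> v w" "\<exists>w\<in>words N n. 0 < v w"
    "\<And>i. i \<in> words N n \<Longrightarrow> radius n * v i \<le> (\<Sum>j\<in>words N n. lower_entry N x y S i j * v j)"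
    using radius_right_weights[of n] by blast
  have sub: "radius n * v i \<le> (\<Sum>a\<in>letters N. scale (i @ [a]) * v (tl i @ [a]))"
    if "i \<in> words N n" for i
    using v(3)[OF that] unfolding sum_lower_entry[OF that n] .
  have tl: "tl i \<in> words N n" if "i \<in> words N (Suc n)" for i
    using that by (cases i) (auto simp: words_def)
  obtain k where k: "k \<in> words N n" "0 < v k" using v(2) by blast
  then have "0 < (\<Sum>a\<in>letters N. scale (k @ [a]) * v (tl k @ [a]))"
    using sub[OF k(1)] pos by (meson mult_pos_pos less_le_trans)
  then obtain a where a: "a \<in> letters N" "0 < scale (k @ [a]) * v (tl k @ [a])"
    by (meson not_less sum_nonpos)
  have k': "k \<noteq> []" using k n by (auto simp: words_def)
  show ?thesis
  proof (rule radius_ge[where l = "\<lambda>i. scale i * v (tl i)"])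
    show "0 \<le> scale w * v (tl w)" if "w \<in> words N (Suc n)" for w
      using scale_nonneg v(1)[OF tl[OF that]] by simp
    show "k @ [a] \<in> words N (Suc n)" using k a by (auto simp: words_def)
    show "0 < scale (k @ [a]) * v (tl (k @ [a]))" using a k' by simp
    fix i assume i: "i \<in> words N (Suc n)"
    then have t: "tl i \<noteq> []" using n by (cases i) (auto simp: words_def)
    have "radius n * (scale i * v (tl i)) = scale i * (radius n * v (tl i))" by simp
    also have "\<dots> \<le> scale i * (\<Sum>a\<in>letters N. scale (tl i @ [a]) * v (tl (tl i) @ [a]))"
      by (intro mult_left_mono sub tl i scale_nonneg)
    also have "\<dots> = (\<Sum>a\<in>letters N. scale i * (scale (tl i @ [a]) * v (tl (tl i @ [a]))))"
      using t by (simp add: sum_distrib_left)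
    also have "\<dots> \<le> (\<Sum>a\<in>letters N. scale (i @ [a]) * (scale (tl i @ [a]) * v (tl (tl i @ [a]))))"
    proof (intro sum_mono mult_right_mono mult_nonneg_nonneg scale_nonneg v(1) tl scale_append_mono)
      show "tl i @ [a] \<in> words N (Suc n)" if "a \<in> letters N" for a
        using tl[OF i] that by (auto simp: words_def)
    qed simp
    also have "\<dots> = (\<Sum>j\<in>words N (Suc n). lower_entry N x y S i j * (scale j * v (tl j)))"
      by (rule sum_lower_entry[OF i, symmetric]) simp
    finally show "radius n * (scale i * v (tl i)) \<le>
        (\<Sum>j\<in>words N (Suc n). lower_entry N x y S i j * (scale j * v (tl j)))" .
  qed
qed

text \<open>Evaluate the subeigenvector inequality at its greatest coordinate: a row has at most one nonzero
  entry for each letter, and no entry exceeds 1.\<close>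

lemma radius_bounded:
  assumes n: "1 \<le> n"
  shows "radius n \<le> card (letters N)"
proof -
  obtain v where v: "\<And>w. w \<in> words N n \<Longrightarrow> 0 \<le> v w" "\<exists>w\<in>words N n. 0 < v w"
    "\<And>i. i \<in> words N n \<Longrightarrow> radius n * v i \<le> (\<Sum>j\<in>words N n. lower_entry N x y S i j * v j)"
    using radius_right_weights[of n] by blast
  have "Max (v ` words N n) \<in> v ` words N n"
    using finite_words words_nonempty by (intro Max_in) auto
  then obtain k where k: "k \<in> words N n" "v k = Max (v ` words N n)" by fastforce
  then have max: "v w \<le> v k" if "w \<in> words N n" for w
    using finite_words that by simp
  then have pos: "0 < v k" using v(2) by force
  have "radius n * v k \<le> (\<Sum>a\<in>letters N. scale (k @ [a]) * v (tl k @ [a]))"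
    using v(3)[OF k(1)] unfolding sum_lower_entry[OF k(1) n] .
  also have "\<dots> \<le> (\<Sum>a\<in>letters N. 1 * v k)"
  proof (rule sum_mono)
    fix a assume a: "a \<in> letters N"
    have "tl k @ [a] \<in> words N n" "set (k @ [a]) \<subseteq> letters N"
      using k(1) a n by (cases k; auto simp: words_def)+
    then show "scale (k @ [a]) * v (tl k @ [a]) \<le> 1 * v k"
      using pos v(1) max by (intro mult_mono scale_le_1) auto
  qed
  also have "\<dots> = card (letters N) * v k" by simp
  finally show ?thesis using pos by simp
qed

lemma radius_tendsto: "radius \<longlonglongrightarrow> rho_star N x y S"
proof -
  have "incseq (\<lambda>n. radius (Suc n))"
    by (rule incseq_SucI) (rule radius_mono, simp)
  moreover have "\<forall>n. radius (Suc n) \<le> card (letters N)"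
    using radius_bounded by simp
  ultimately obtain L where "(\<lambda>n. radius (Suc n)) \<longlonglongrightarrow> L"
    using incseq_convergent by blast
  then have "radius \<longlonglongrightarrow> L" by (rule LIMSEQ_imp_Suc)
  then show ?thesis unfolding rho_star_def by (simp add: limI)
qed

lemma rho_star_nonneg: "0 \<le> rho_star N x y S"
  by (rule LIMSEQ_le_const[OF radius_tendsto]) (use radius_nonneg in blast)

end

section \<open>Invariant sets of the folding maps\<close>

context fold_grid
begin

lemma cell_map_same_image:
  assumes "v \<in> letters N" "w \<in> letters N" "s \<in> D" "t \<in> D" "cell_map N x y v s = cell_map N x y w t"
  shows "s = t"
  using assms X.fold_map_same_image(1)[of "fst v" "fst w" "fst s" "fst t"]
    Y.fold_map_same_image(1)[of "snd v" "snd w" "snd s" "snd t"]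
  unfolding mem_letters mem_D cell_map_def prod.inject by (simp add: prod_eq_iff)

definition end_coords :: "real \<times> real \<Rightarrow> nat" where
  "end_coords t = of_bool (fst t \<in> {x 0, x N}) + of_bool (snd t \<in> {y 0, y N})"

lemma end_coords_le:
  assumes w: "w \<in> letters N" and t: "t \<in> D"
  shows "end_coords (cell_map N x y w t) \<le> end_coords t"
proof -
  have "fst t \<in> {x 0, x N}" if "fst (cell_map N x y w t) \<in> {x 0, x N}"
    using X.fold_map_endpoint[of "fst w" "fst t"] that w t
    unfolding mem_letters mem_D cell_map_def fst_conv by blast
  moreover have "snd t \<in> {y 0, y N}" if "snd (cell_map N x y w t) \<in> {y 0, y N}"
    using Y.fold_map_endpoint[of "snd w" "snd t"] that w t
    unfolding mem_letters mem_D cell_map_def snd_conv by blast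
  ultimately show ?thesis unfolding end_coords_def by (intro add_mono) (auto simp: of_bool_def)
qed

text \<open>If two letters send \<open>t\<close> to the same point, they differ in some coordinate, and there the
  folding moves an end point to an interior grid point.\<close>

lemma end_coords_less:
  assumes vw: "v \<in> letters N" "w \<in> letters N" "v \<noteq> w" and t: "t \<in> D"
    and eq: "cell_map N x y v t = cell_map N x y w t"
  shows "end_coords (cell_map N x y v t) < end_coords t"
proof -
  have eqs: "fold_map N x (fst v) (fst t) = fold_map N x (fst w) (fst t)"
    "fold_map N y (snd v) (snd t) = fold_map N y (snd w) (snd t)"
    using eq by (auto simp: cell_map_def)
  have le1: "fst t \<in> {x 0, x N}" if "fst (cell_map N x y v t) \<in> {x 0, x N}"
    using X.fold_map_endpoint[of "fst v" "fst t"] that vw t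
    unfolding mem_letters mem_D cell_map_def fst_conv by blast
  have le2: "snd t \<in> {y 0, y N}" if "snd (cell_map N x y v t) \<in> {y 0, y N}"
    using Y.fold_map_endpoint[of "snd v" "snd t"] that vw t
    unfolding mem_letters mem_D cell_map_def snd_conv by blast
  have "fst v \<noteq> fst w \<or> snd v \<noteq> snd w" using vw(3) by (auto simp: prod_eq_iff)
  then have "(fst t \<in> {x 0, x N} \<and> fst (cell_map N x y v t) \<notin> {x 0, x N})
     \<or> (snd t \<in> {y 0, y N} \<and> snd (cell_map N x y v t) \<notin> {y 0, y N})"
    using X.fold_map_same_image(2)[OF _ _ _ _ eqs(1)] Y.fold_map_same_image(2)[OF _ _ _ _ eqs(2)] vw t
    by (force simp: mem_letters mem_D cell_map_def)
  then show ?thesis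
    unfolding end_coords_def using le1 le2 by (auto simp: of_bool_def split: if_splits)
qed

end

context scaled_grid
begin

lemma two_letters:
  assumes t: "t \<in> D" and sum: "1 \<le> sum_fun N x y S t"
  obtains v w where "v \<in> letters N" "w \<in> letters N" "v \<noteq> w"
    "S (cell_map N x y v t) \<noteq> 0" "S (cell_map N x y w t) \<noteq> 0"
proof -
  let ?g = "\<lambda>w. \<bar>S (cell_map N x y w t)\<bar>"
  have "(\<Sum>w\<in>letters N. ?g w) \<noteq> 0" using sum by (simp add: sum_fun_def)
  then obtain v where v: "v \<in> letters N" "S (cell_map N x y v t) \<noteq> 0"
    by (metis (no_types, lifting) abs_zero sum.neutral)
  have "(\<Sum>w\<in>letters N. ?g w) = ?g v + (\<Sum>w\<in>letters N - {v}. ?g w)"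
    using v by (intro sum.remove finite_letters)
  moreover have "?g v < 1" using S_less_1 cell_map_in v t by blast
  ultimately have "(\<Sum>w\<in>letters N - {v}. ?g w) \<noteq> 0" using sum by (simp add: sum_fun_def)
  then obtain w where "w \<in> letters N - {v}" "S (cell_map N x y w t) \<noteq> 0"
    by (metis (no_types, lifting) abs_zero sum.neutral)
  then show thesis using that v by blast
qed

text \<open>Since \<open>|S| < 1\<close> and \<open>\<gamma> \<ge> 1\<close>, every point has at least two letters with nonzero scaling. Among
  the points of an invariant set with the least number of coordinates at an end of the interval,
  the images under two such letters are different, for a coincidence would move an end coordinate
  to the interior; and different points have disjoint sets of images. So these points would be at
  least twice as many as they are.\<close>

lemma no_finite_invariant_set:
  assumes T: "finite T" "T \<noteq> {}" "T \<subseteq> D"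
    and inv: "\<And>t w. t \<in> T \<Longrightarrow> w \<in> letters N \<Longrightarrow> S (cell_map N x y w t) \<noteq> 0 \<Longrightarrow> cell_map N x y w t \<in> T"
    and sum: "\<And>t. t \<in> D \<Longrightarrow> 1 \<le> sum_fun N x y S t"
  shows False
proof -
  define m where "m = Min (end_coords ` T)"
  define Q where "Q = {t \<in> T. end_coords t = m}"
  define children where "children t = {cell_map N x y w t | w. w \<in> letters N \<and> S (cell_map N x y w t) \<noteq> 0}" for t
  have m: "m \<le> end_coords t" if "t \<in> T" for t using that T by (simp add: m_def)
  have "m \<in> end_coords ` T" using T unfolding m_def by (intro Min_in) auto
  then have Q: "finite Q" "Q \<noteq> {}" "Q \<subseteq> D" using T by (auto simp: Q_def)
  have child: "children t \<subseteq> Q" if t: "t \<in> Q" for t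
  proof
    fix c assume "c \<in> children t"
    then obtain w where w: "w \<in> letters N" "c = cell_map N x y w t" "S c \<noteq> 0"
      by (auto simp: children_def)
    have "c \<in> T" using inv w t by (auto simp: Q_def)
    moreover have "t \<in> D" "end_coords t = m" using t Q by (auto simp: Q_def)
    then have "end_coords c \<le> m" using end_coords_le[OF w(1), of t] w(2) by simp
    ultimately show "c \<in> Q" using m[of c] by (simp add: Q_def)
  qed
  have two: "2 \<le> card (children t)" if t: "t \<in> Q" for t
  proof -
    have tD: "t \<in> D" using t Q by blast
    obtain v w where vw: "v \<in> letters N" "w \<in> letters N" "v \<noteq> w"
      "S (cell_map N x y v t) \<noteq> 0" "S (cell_map N x y w t) \<noteq> 0"
      using two_letters[OF tD sum[OF tD]] .
    let ?c = "{cell_map N x y v t, cell_map N x y w t}"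
    have sub: "?c \<subseteq> children t" using vw unfolding children_def by blast
    have "cell_map N x y v t \<noteq> cell_map N x y w t"
    proof
      assume "cell_map N x y v t = cell_map N x y w t"
      from end_coords_less[OF vw(1-3) tD this] have "end_coords (cell_map N x y v t) < m"
        using t by (simp add: Q_def)
      moreover have "cell_map N x y v t \<in> T" using sub child[OF t] by (auto simp: Q_def)
      ultimately show False using m[of "cell_map N x y v t"] by simp
    qed
    then have "2 = card ?c" by simp
    also have "\<dots> \<le> card (children t)"
      using sub finite_subset[OF child[OF t] Q(1)] by (intro card_mono)
    finally show ?thesis .
  qed
  have disj: "children s \<inter> children t = {}" if "s \<in> Q" "t \<in> Q" "s \<noteq> t" for s t
    using cell_map_same_image that Q(3) unfolding children_def by blast
  have "2 * card Q \<le> (\<Sum>t\<in>Q. card (children t))"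
    using sum_mono[of Q "\<lambda>_. 2" "\<lambda>t. card (children t)"] two by simp
  also have "\<dots> = card (\<Union>t\<in>Q. children t)"
    using Q(1) disj finite_subset[OF child Q(1)] by (intro card_UN_disjoint[symmetric] ballI impI)
  also have "\<dots> \<le> card Q" using child Q by (intro card_mono) auto
  finally show False using Q by (simp add: card_eq_0_iff)
qed

end

section \<open>Oscillation sums of a self-affine surface\<close>

lemma sum_words_append:
  "(\<Sum>w\<in>words N (k + p). g w) = (\<Sum>u\<in>words N k. \<Sum>v\<in>words N p. g (u @ v))"
proof -
  have "(\<Sum>u\<in>words N k. \<Sum>v\<in>words N p. g (u @ v)) = (\<Sum>(u, v)\<in>words N k \<times> words N p. g (u @ v))"
    by (rule sum.cartesian_product)
  also have "\<dots> = (\<Sum>w\<in>words N (k + p). g w)"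
    by (rule sum.reindex_bij_witness[of _ "\<lambda>w. (take k w, drop k w)" "\<lambda>(u, v). u @ v"])
      (auto simp: words_def dest: in_set_takeD in_set_dropD)
  finally show ?thesis by simp
qed

lemma sum_words_1: "(\<Sum>w\<in>words N 1. g w) = (\<Sum>a\<in>letters N. g [a])"
  by (rule sum.reindex_bij_witness[of _ "\<lambda>a. [a]" hd]) (auto simp: words_def length_Suc_conv)

lemma card_words: "card (words N p) = card (letters N) ^ p"
  unfolding words_def by (rule card_lists_length_eq) (simp add: letters_def)

lemma card_letters: "card (letters N) = N ^ 2"
  by (simp add: letters_def card_cartesian_product power2_eq_square)

locale self_affine_surface = scaled_grid N x y S for N x y S +
  fixes f q :: "real \<times> real \<Rightarrow> real" and lambdaS lambdaq :: real
  assumes f_continuous: "continuous_on D f"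
    and f_self_affine: "w \<in> letters N \<Longrightarrow> t \<in> D \<Longrightarrow>
      f (cell_map N x y w t) = S (cell_map N x y w t) * f t + q (cell_map N x y w t)"
    and S_lipschitz: "lambdaS-lipschitz_on D S"
    and q_lipschitz: "lambdaq-lipschitz_on D q"
begin

abbreviation cell_osc :: "(nat \<times> nat) list \<Rightarrow> real" where
  "cell_osc w \<equiv> osc f (word_cell N x y w)"

lemma f_continuous_cell: "set w \<subseteq> letters N \<Longrightarrow> continuous_on (word_cell N x y w) f"
  using f_continuous word_cell_subset by (rule continuous_on_subset)

lemma cell_osc_nonneg: "set w \<subseteq> letters N \<Longrightarrow> 0 \<le> cell_osc w"
  by (rule osc_nonneg[OF word_cell_topology(1,3) f_continuous_cell])

definition f_bound :: real where "f_bound = (SOME M. \<forall>t\<in>D. \<bar>f t\<bar> \<le> M)"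

lemma abs_f_le: "t \<in> D \<Longrightarrow> \<bar>f t\<bar> \<le> f_bound"
proof -
  have "compact (f ` D)"
    using compact_continuous_image[OF f_continuous] word_cell_topology(1)[of "[]"]
    by (simp add: word_cell_Nil)
  then have "bounded (f ` D)" by (rule compact_imp_bounded)
  then have "\<exists>M. \<forall>t\<in>D. \<bar>f t\<bar> \<le> M" unfolding bounded_iff by auto
  then show "t \<in> D \<Longrightarrow> \<bar>f t\<bar> \<le> f_bound"
    unfolding f_bound_def by (rule someI2_ex) blast
qed

text \<open>The factor \<open>2 * width\<close>, divided by \<open>N\<^sup>p\<close>, bounds the diameter of a cell of generation \<open>p\<close>; the
  other factor is a Lipschitz constant of \<open>r \<mapsto> S r * c + q r\<close> for all \<open>c\<close> in the range of \<open>f\<close>.\<close>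

definition defect :: real where "defect = (lambdaS * f_bound + lambdaq) * (2 * width)"

lemma f_bound_nonneg: "0 \<le> f_bound"
  using D_nonempty abs_f_le by (metis abs_ge_zero all_not_in_conv order_trans)

lemma defect_nonneg: "0 \<le> defect"
  unfolding defect_def
  using lipschitz_on_nonneg[OF S_lipschitz] lipschitz_on_nonneg[OF q_lipschitz] f_bound_nonneg width_pos
  by simp

text \<open>Passing to the image under \<open>L\<^sub>a\<close> multiplies the oscillation by at least the least value of
  \<open>|S|\<close>, up to the variation of \<open>S\<close> and \<open>q\<close> on the small cell.\<close>

lemma cell_osc_Cons:
  assumes a: "a \<in> letters N" and v: "v \<in> words N p"
  shows "scale (a # v) * cell_osc v - defect / real N ^ p \<le> cell_osc (a # v)"
proof -
  have v': "set v \<subseteq> letters N" "set (a # v) \<subseteq> letters N" "a # v \<in> words N (Suc p)"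
    using v a by (auto simp: words_def)
  obtain s t where st: "s \<in> word_cell N x y v" "t \<in> word_cell N x y v" "cell_osc v = f s - f t"
    using osc_attained[OF word_cell_topology(1,3) f_continuous_cell[OF v'(1)]] by blast
  define s' t' where "s' = cell_map N x y a s" and "t' = cell_map N x y a t"
  have cell: "s' \<in> word_cell N x y (a # v)" "t' \<in> word_cell N x y (a # v)"
    using st by (auto simp: s'_def t'_def word_cell_Cons)
  have D: "s \<in> D" "t \<in> D" "s' \<in> D" "t' \<in> D"
    using st cell word_cell_subset v' by blast+
  have dist: "dist s' t' \<le> 2 * width / real N ^ p"
  proof -
    have "dist s' t' \<le> 2 * width / real N ^ Suc p" using word_cell_diameter[OF v'(3) cell] .
    also have "\<dots> \<le> 2 * width / real N ^ p"
      using width_pos X.two_le_N by (intro divide_left_mono) auto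
    finally show ?thesis .
  qed
  have eq: "f s' - f t' = S s' * (f s - f t) + ((S s' - S t') * f t + (q s' - q t'))"
    using f_self_affine[OF a D(1)] f_self_affine[OF a D(2)]
    by (simp add: s'_def t'_def algebra_simps)
  have "\<bar>(S s' - S t') * f t + (q s' - q t')\<bar> \<le> \<bar>S s' - S t'\<bar> * \<bar>f t\<bar> + \<bar>q s' - q t'\<bar>"
    by (metis abs_mult abs_triangle_ineq)
  also have "\<dots> \<le> (lambdaS * dist s' t') * f_bound + lambdaq * dist s' t'"
    using lipschitz_onD[OF S_lipschitz D(3,4)] lipschitz_onD[OF q_lipschitz D(3,4)] abs_f_le[OF D(2)]
      lipschitz_on_nonneg[OF S_lipschitz]
    by (intro add_mono mult_mono) (auto simp: dist_real_def)
  also have "\<dots> = (lambdaS * f_bound + lambdaq) * dist s' t'" by (simp add: algebra_simps)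
  also have "\<dots> \<le> (lambdaS * f_bound + lambdaq) * (2 * width / real N ^ p)"
    using dist lipschitz_on_nonneg[OF S_lipschitz] lipschitz_on_nonneg[OF q_lipschitz] f_bound_nonneg
    by (intro mult_left_mono) auto
  also have "\<dots> = defect / real N ^ p" by (simp add: defect_def)
  finally have err: "\<bar>(S s' - S t') * f t + (q s' - q t')\<bar> \<le> defect / real N ^ p" .
  have "scale (a # v) * cell_osc v \<le> \<bar>S s'\<bar> * cell_osc v"
    by (intro mult_right_mono scale_le cell cell_osc_nonneg v')
  also have "\<dots> = \<bar>S s' * (f s - f t)\<bar>"
    using cell_osc_nonneg[OF v'(1)] by (simp add: abs_mult st(3))
  also have "\<dots> \<le> \<bar>f s' - f t'\<bar> + defect / real N ^ p" using eq err by linarith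
  also have "\<bar>f s' - f t'\<bar> \<le> cell_osc (a # v)"
  proof -
    obtain u1 u2 where "cell_osc (a # v) = f u1 - f u2"
      "\<And>u. u \<in> word_cell N x y (a # v) \<Longrightarrow> f u2 \<le> f u \<and> f u \<le> f u1"
      using osc_attained[OF word_cell_topology(1,3) f_continuous_cell[OF v'(2)]] by blast
    then show ?thesis using cell by (smt (verit))
  qed
  finally show ?thesis by simp
qed

definition local_osc_sum :: "nat \<Rightarrow> (nat \<times> nat) list \<Rightarrow> real" where
  "local_osc_sum p w = (\<Sum>u\<in>words N p. cell_osc (w @ u))"

lemma osc_sum_eq: "osc_sum N x y f p = local_osc_sum p []"
  by (simp add: osc_sum_def local_osc_sum_def)

lemma local_osc_sum_nonneg: "set w \<subseteq> letters N \<Longrightarrow> 0 \<le> local_osc_sum p w"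
  unfolding local_osc_sum_def by (intro sum_nonneg cell_osc_nonneg) (auto simp: words_def)

lemma local_osc_sum_add: "local_osc_sum (k + p) w = (\<Sum>u\<in>words N k. local_osc_sum p (w @ u))"
  by (simp add: local_osc_sum_def sum_words_append)

lemma local_osc_sum_append_le:
  assumes w: "set w \<subseteq> letters N" and u: "u \<in> words N k"
  shows "local_osc_sum p (w @ u) \<le> local_osc_sum (k + p) w"
  unfolding local_osc_sum_add using u w
  by (intro member_le_sum finite_words local_osc_sum_nonneg) (auto simp: words_def)

text \<open>The \<open>N\<^sup>2\<^sup>p\<close> cells of generation \<open>p\<close> contribute an error \<open>defect / N\<^sup>p\<close> each.\<close>

lemma local_osc_sum_Cons:
  assumes a: "a \<in> letters N" and w: "set w \<subseteq> letters N"
  shows "scale (a # w) * local_osc_sum p w - defect * real N ^ p \<le> local_osc_sum p (a # w)"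
proof -
  have N: "real N ^ p > 0" using N_pos by simp
  have "scale (a # w) * cell_osc (w @ u) - defect / real N ^ p \<le> cell_osc ((a # w) @ u)"
    if u: "u \<in> words N p" for u
  proof -
    have su: "set u \<subseteq> letters N" "w @ u \<in> words N (length w + p)" "set (w @ u) \<subseteq> letters N"
      using u w by (auto simp: words_def)
    have "scale (a # w) * cell_osc (w @ u) \<le> scale (a # (w @ u)) * cell_osc (w @ u)"
      using scale_append_mono[OF su(1), of "a # w"]
      by (intro mult_right_mono cell_osc_nonneg su) simp
    moreover have "defect / real N ^ (length w + p) \<le> defect / real N ^ p"
      using defect_nonneg N_pos X.two_le_N by (intro divide_left_mono power_increasing) auto
    ultimately show ?thesis using cell_osc_Cons[OF a su(2)] by simp
  qed
  then have "(\<Sum>u\<in>words N p. scale (a # w) * cell_osc (w @ u) - defect / real N ^ p) \<le> local_osc_sum p (a # w)"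
    unfolding local_osc_sum_def by (rule sum_mono)
  moreover have "(\<Sum>u\<in>words N p. scale (a # w) * cell_osc (w @ u) - defect / real N ^ p)
      = scale (a # w) * local_osc_sum p w - card (words N p) * (defect / real N ^ p)"
    by (simp add: sum_subtractf local_osc_sum_def sum_distrib_left)
  moreover have "card (words N p) * (defect / real N ^ p) = defect * real N ^ p"
    using N by (simp add: card_words card_letters power_mult[symmetric] mult_2 power_add)
  ultimately show ?thesis by simp
qed

text \<open>Split the sum by the letter that follows \<open>i\<close>, then remove the first letter of \<open>i\<close>: the word
  \<open>i\<^sub>1\<dots>i\<^sub>n a\<close> becomes \<open>i\<^sub>2\<dots>i\<^sub>n a\<close>, which is the transition that the scaling matrix describes.\<close>

lemma local_osc_sum_Suc:
  assumes i: "i \<in> words N n" and n: "1 \<le> n"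
  shows "(\<Sum>j\<in>words N n. lower_entry N x y S i j * local_osc_sum p j)
           - defect * card (letters N) * real N ^ p \<le> local_osc_sum (Suc p) i"
proof -
  obtain b i' where i': "i = b # i'" using i n by (cases i) (auto simp: words_def)
  have set: "b \<in> letters N" "set i' \<subseteq> letters N" using i by (auto simp: i' words_def)
  have "(\<Sum>a\<in>letters N. scale (i @ [a]) * local_osc_sum p (tl i @ [a]) - defect * real N ^ p)
      \<le> (\<Sum>a\<in>letters N. local_osc_sum p (i @ [a]))"
  proof (rule sum_mono)
    fix a assume "a \<in> letters N"
    then show "scale (i @ [a]) * local_osc_sum p (tl i @ [a]) - defect * real N ^ p \<le> local_osc_sum p (i @ [a])"
      using local_osc_sum_Cons[OF set(1), of "i' @ [a]"] set by (simp add: i')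
  qed
  also have "\<dots> = local_osc_sum (Suc p) i"
    using local_osc_sum_add[of 1 p i] by (simp only: sum_words_1 plus_1_eq_Suc)
  finally show ?thesis
    unfolding sum_lower_entry[OF i n] by (simp add: sum_subtractf mult_ac)
qed

section \<open>Cells with unbounded oscillation sums\<close>

text \<open>The growth rate \<open>N\<^sup>p\<close> is the critical one, because the errors in the recursion for the local
  oscillation sums are of this order.\<close>

definition rough :: "(nat \<times> nat) list \<Rightarrow> bool" where
  "rough w \<longleftrightarrow> (\<forall>B. \<exists>p. B * real N ^ p < local_osc_sum p w)"

lemma rough_prefix:
  assumes w: "set w \<subseteq> letters N" and u: "set u \<subseteq> letters N" and r: "rough (w @ u)"
  shows "rough w"
  unfolding rough_def
proof
  fix B
  obtain p where "(B * real N ^ length u) * real N ^ p < local_osc_sum p (w @ u)"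
    using r unfolding rough_def by blast
  also have "\<dots> \<le> local_osc_sum (length u + p) w"
    using w u by (intro local_osc_sum_append_le) (auto simp: words_def)
  finally show "\<exists>p. B * real N ^ p < local_osc_sum p w"
    by (intro exI[of _ "length u + p"]) (simp add: power_add mult_ac)
qed

text \<open>One of finitely many summands must be unbounded.\<close>

lemma rough_extend:
  assumes w: "set w \<subseteq> letters N" and r: "rough w"
  obtains a where "a \<in> letters N" "rough (w @ [a])"
proof (rule ccontr)
  assume "\<not> thesis"
  then have "\<forall>a\<in>letters N. \<exists>B. \<forall>p. local_osc_sum p (w @ [a]) \<le> B * real N ^ p"
    using that unfolding rough_def by (meson not_le)
  then obtain B where B: "\<And>a p. a \<in> letters N \<Longrightarrow> local_osc_sum p (w @ [a]) \<le> B a * real N ^ p"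
    by metis
  \<comment> \<open>Generation 0 is not a sum over subcells and is bounded separately.\<close>
  define C where "C = max (local_osc_sum 0 w) (\<Sum>a\<in>letters N. B a)"
  have C0: "0 \<le> C" using local_osc_sum_nonneg[OF w, of 0] by (simp add: C_def)
  have "local_osc_sum p w \<le> C * real N ^ p" for p
  proof (cases p)
    case 0
    then show ?thesis by (simp add: C_def)
  next
    case (Suc k)
    have "local_osc_sum p w = (\<Sum>a\<in>letters N. local_osc_sum k (w @ [a]))"
      using local_osc_sum_add[of 1 k w] by (simp only: Suc sum_words_1 plus_1_eq_Suc)
    also have "\<dots> \<le> (\<Sum>a\<in>letters N. B a * real N ^ k)" by (intro sum_mono B)
    also have "\<dots> = (\<Sum>a\<in>letters N. B a) * real N ^ k" by (simp add: sum_distrib_right)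
    also have "\<dots> \<le> C * real N ^ k" by (intro mult_right_mono) (auto simp: C_def)
    also have "\<dots> \<le> C * real N ^ p"
      using C0 X.two_le_N by (intro mult_left_mono) (auto simp: Suc)
    finally show ?thesis .
  qed
  then show False using r unfolding rough_def by (meson not_le)
qed

lemma rough_Cons:
  assumes a: "a \<in> letters N" and w: "set w \<subseteq> letters N" and r: "rough w" and s: "0 < scale (a # w)"
  shows "rough (a # w)"
  unfolding rough_def
proof
  fix B
  obtain p where "(B + defect) / scale (a # w) * real N ^ p < local_osc_sum p w"
    using r unfolding rough_def by blast
  then have "(B + defect) * real N ^ p < scale (a # w) * local_osc_sum p w"
    using s by (simp add: field_simps)
  then have "B * real N ^ p < scale (a # w) * local_osc_sum p w - defect * real N ^ p"
    by (simp add: algebra_simps)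
  also have "\<dots> \<le> local_osc_sum p (a # w)" by (rule local_osc_sum_Cons[OF a w])
  finally show "\<exists>p. B * real N ^ p < local_osc_sum p (a # w)" by blast
qed

lemma rough_Nil:
  assumes "limsup (\<lambda>p. ereal (osc_sum N x y f p / real N ^ p)) = \<infinity>"
  shows "rough []"
proof (rule ccontr)
  assume "\<not> rough []"
  then obtain B where "\<And>p. local_osc_sum p [] \<le> B * real N ^ p"
    unfolding rough_def by (meson not_le)
  then have "osc_sum N x y f p / real N ^ p \<le> B" for p
    using N_pos by (simp add: osc_sum_eq divide_le_eq)
  then have "limsup (\<lambda>p. ereal (osc_sum N x y f p / real N ^ p)) \<le> ereal B"
    by (intro Limsup_bounded) simp
  then show False using assms by simp
qed

lemma S_continuous: "continuous_on D S"
  by (rule lipschitz_on_continuous_on[OF S_lipschitz])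

text \<open>By compactness \<open>|S|\<close> is bounded away from zero on every cell, so roughness passes to all
  images of the whole square.\<close>

lemma all_rough_of_no_zero:
  assumes r: "rough []" and S: "\<And>t. t \<in> D \<Longrightarrow> S t \<noteq> 0" and w: "set w \<subseteq> letters N"
  shows "rough w"
  using w
proof (induction w)
  case (Cons a w)
  have sub: "word_cell N x y (a # w) \<subseteq> D" by (rule word_cell_subset[OF Cons.prems])
  obtain t where t: "t \<in> word_cell N x y (a # w)"
    "\<And>u. u \<in> word_cell N x y (a # w) \<Longrightarrow> \<bar>S t\<bar> \<le> \<bar>S u\<bar>"
    using continuous_attains_inf[OF word_cell_topology(1,3)]
      continuous_on_rabs[OF continuous_on_subset[OF S_continuous sub]] by metis
  have "S t \<noteq> 0" using S t(1) sub by blast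
  then have "0 < \<bar>S t\<bar>" by simp
  also have "\<bar>S t\<bar> \<le> scale (a # w)" using t(2) by (rule scale_greatest)
  finally show ?case using Cons by (intro rough_Cons) auto
qed (rule r)

text \<open>Roughness near a point is expressed by cells inside the cell of \<open>w\<close> and not by
  neighbourhoods: on the border of that cell a neighbourhood may be rough because of an adjacent
  cell only.\<close>

definition rough_points :: "(nat \<times> nat) list \<Rightarrow> (real \<times> real) set" where
  "rough_points w = {t \<in> D. \<forall>k. \<exists>u\<in>words N k. rough (w @ u) \<and> t \<in> word_cell N x y (w @ u)}"

text \<open>Choose letters one after the other so that the cell stays rough; the nested cells have a
  common point.\<close>

lemma rough_points_nonempty:
  assumes r: "rough []"
  shows "rough_points [] \<noteq> {}"
proof -
  have "\<exists>u. \<forall>n. (u n \<in> words N n \<and> rough (u n)) \<and> (\<exists>a\<in>letters N. u (Suc n) = u n @ [a])"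
  proof (rule dependent_nat_choice)
    show "\<exists>u. u \<in> words N 0 \<and> rough u" using r by (intro exI[of _ "[]"]) (simp add: words_def)
    fix u n assume u: "u \<in> words N n \<and> rough u"
    then obtain a where "a \<in> letters N" "rough (u @ [a])"
      using rough_extend[of u] by (auto simp: words_def)
    then show "\<exists>v. (v \<in> words N (Suc n) \<and> rough v) \<and> (\<exists>a\<in>letters N. v = u @ [a])"
      using u by (intro exI[of _ "u @ [a]"]) (auto simp: words_def)
  qed
  then obtain u where u: "\<And>n. u n \<in> words N n" "\<And>n. rough (u n)"
    "\<And>n. \<exists>a\<in>letters N. u (Suc n) = u n @ [a]" by blast
  have step: "word_cell N x y (u (Suc n)) \<subseteq> word_cell N x y (u n)" for n
  proof -
    obtain a where a: "a \<in> letters N" "u (Suc n) = u n @ [a]" using u(3) by blast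
    show ?thesis unfolding a(2) using a(1) by (intro word_cell_append_subset) simp
  qed
  have "word_cell N x y (u n) \<subseteq> word_cell N x y (u m)" if "m \<le> n" for m n
    using lift_Suc_antimono_le[of "\<lambda>n. word_cell N x y (u n)", OF step that] .
  then have "\<Inter> (range (\<lambda>n. word_cell N x y (u n))) \<noteq> {}"
    by (intro compact_nest word_cell_topology) auto
  then obtain t where t: "\<And>n. t \<in> word_cell N x y (u n)" by blast
  have "t \<in> D" using t[of 0] word_cell_subset[of "u 0"] u(1)[of 0] by (auto simp: words_def)
  moreover have "\<exists>v\<in>words N k. rough ([] @ v) \<and> t \<in> word_cell N x y ([] @ v)" for k
    using u t by (intro bexI[of _ "u k"]) simp_all
  ultimately have "t \<in> rough_points []" by (simp add: rough_points_def)
  then show ?thesis by blast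
qed

lemma rough_points_subset_Nil:
  assumes w: "set w \<subseteq> letters N"
  shows "rough_points w \<subseteq> rough_points []"
proof
  fix t assume t: "t \<in> rough_points w"
  have "\<exists>u\<in>words N k. rough ([] @ u) \<and> t \<in> word_cell N x y ([] @ u)" for k
  proof -
    obtain u where u: "u \<in> words N k" "rough (w @ u)" "t \<in> word_cell N x y (w @ u)"
      using t unfolding rough_points_def by blast
    define v v' where "v = take k (w @ u)" and "v' = drop k (w @ u)"
    have vv: "w @ u = v @ v'" by (simp only: v_def v'_def append_take_drop_id)
    have "set (v @ v') \<subseteq> letters N" using u(1) w unfolding vv[symmetric] by (auto simp: words_def)
    then have set: "set v \<subseteq> letters N" "set v' \<subseteq> letters N" by auto
    have "v \<in> words N k" using set(1) u(1) by (auto simp: words_def v_def)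
    then show ?thesis
      using rough_prefix[OF set] word_cell_append_subset[OF set(2), of v] u(2,3) unfolding vv by auto
  qed
  then show "t \<in> rough_points []" using t by (simp add: rough_points_def)
qed

text \<open>By continuity \<open>S\<close> has no zero on the small cells around the image point, so roughness of
  the small cells around \<open>t\<close> is passed on; larger cells inherit it.\<close>

lemma rough_points_Cons:
  assumes a: "a \<in> letters N" and w: "set w \<subseteq> letters N" and t: "t \<in> rough_points w"
    and S: "S (cell_map N x y a t) \<noteq> 0"
  shows "cell_map N x y a t \<in> rough_points (a # w)"
proof -
  let ?t = "cell_map N x y a t"
  have tD: "t \<in> D" using t by (simp add: rough_points_def)
  have D: "?t \<in> D" by (rule cell_map_in[OF a tD])
  have "(\<lambda>p. lambdaS * (2 * width) * inverse (real N) ^ p) \<longlonglongrightarrow> lambdaS * (2 * width) * 0"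
    using X.two_le_N by (intro tendsto_mult tendsto_const LIMSEQ_realpow_zero) (auto simp: inverse_less_1_iff)
  then have "\<forall>\<^sub>F p in sequentially. lambdaS * (2 * width) * inverse (real N) ^ p < \<bar>S ?t\<bar>"
    using S by (intro order_tendstoD(2)) auto
  then obtain P where P: "\<And>p. P \<le> p \<Longrightarrow> lambdaS * (2 * width) * inverse (real N) ^ p < \<bar>S ?t\<bar>"
    unfolding eventually_sequentially by blast
  have "\<exists>u\<in>words N k. rough ((a # w) @ u) \<and> ?t \<in> word_cell N x y ((a # w) @ u)" for k
  proof -
    obtain u where u: "u \<in> words N (k + P)" "rough (w @ u)" "t \<in> word_cell N x y (w @ u)"
      using t unfolding rough_points_def by blast
    let ?w = "a # (w @ u)"
    have ws: "?w \<in> words N (Suc (length w + (k + P)))" "set ?w \<subseteq> letters N"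
      using u(1) w a by (auto simp: words_def)
    have tw: "?t \<in> word_cell N x y ?w" using u(3) by (simp add: word_cell_Cons)
    have "\<bar>S ?t\<bar> - lambdaS * (2 * width / real N ^ Suc (length w + (k + P))) \<le> \<bar>S r\<bar>"
      if r: "r \<in> word_cell N x y ?w" for r
    proof -
      have "r \<in> D" using r word_cell_subset[OF ws(2)] by blast
      then have "\<bar>S ?t - S r\<bar> \<le> lambdaS * dist ?t r"
        using lipschitz_onD[OF S_lipschitz D] by (simp add: dist_real_def)
      also have "\<dots> \<le> lambdaS * (2 * width / real N ^ Suc (length w + (k + P)))"
        using word_cell_diameter[OF ws(1) tw r] lipschitz_on_nonneg[OF S_lipschitz]
        by (intro mult_left_mono) simp_all
      finally show ?thesis by linarith
    qed
    then have "\<bar>S ?t\<bar> - lambdaS * (2 * width / real N ^ Suc (length w + (k + P))) \<le> scale ?w"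
      by (rule scale_greatest)
    moreover have "lambdaS * (2 * width / real N ^ Suc (length w + (k + P))) < \<bar>S ?t\<bar>"
      using P[of "Suc (length w + (k + P))"] by (simp add: power_inverse divide_inverse mult_ac)
    ultimately have "rough ?w"
      using u(2) ws by (intro rough_Cons) auto
    define v v' where "v = take k u" and "v' = drop k u"
    have vv: "u = v @ v'" by (simp add: v_def v'_def)
    have set: "set v \<subseteq> letters N" "set v' \<subseteq> letters N" "set (a # w @ v) \<subseteq> letters N"
      using u(1) a w unfolding vv by (auto simp: words_def)
    have "v \<in> words N k" using set(1) u(1) by (auto simp: words_def v_def)
    moreover have "rough ((a # w) @ v)"
      using rough_prefix[OF set(3,2)] \<open>rough ?w\<close> by (simp add: vv)
    moreover have "?t \<in> word_cell N x y ((a # w) @ v)"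
      using word_cell_append_subset[OF set(2), of "(a # w) @ v"] tw by (auto simp: vv)
    ultimately show ?thesis by blast
  qed
  then show ?thesis using D by (simp add: rough_points_def)
qed

text \<open>The set of rough points is nonempty and invariant under the maps \<open>L\<^sub>a\<close> as far as \<open>S\<close> does not
  vanish, hence infinite. Going from the cell of \<open>w\<close> to that of \<open>a # w\<close> loses only the finitely many
  rough points that are sent to zeros of \<open>S\<close>, so every cell keeps infinitely many.\<close>

lemma all_rough_of_sum_fun:
  assumes r: "rough []" and sum: "\<And>t. t \<in> D \<Longrightarrow> 1 \<le> sum_fun N x y S t"
    and fin: "finite {t \<in> D. S t = 0}" and w: "set w \<subseteq> letters N"
  shows "rough w"
proof -
  have inf_Nil: "infinite (rough_points [])"
  proof
    assume "finite (rough_points [])"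
    moreover have "rough_points [] \<subseteq> D" by (auto simp: rough_points_def)
    moreover have "cell_map N x y a t \<in> rough_points []"
      if "t \<in> rough_points []" "a \<in> letters N" "S (cell_map N x y a t) \<noteq> 0" for a t
      using rough_points_Cons[OF that(2) _ that(1,3)] rough_points_subset_Nil[of "[a]"] that(2) by auto
    ultimately show False
      using no_finite_invariant_set rough_points_nonempty[OF r] sum by blast
  qed
  have "infinite (rough_points w)"
    using w
  proof (induction w)
    case (Cons a w)
    then have a: "a \<in> letters N" and w: "set w \<subseteq> letters N" and inf: "infinite (rough_points w)" by auto
    let ?Z = "{t \<in> D. S (cell_map N x y a t) = 0}"
    have inj: "inj_on (cell_map N x y a) Z" if "Z \<subseteq> D" for Z
      unfolding inj_on_def using cell_map_same_image[OF a a] that by blast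
    have "cell_map N x y a ` ?Z \<subseteq> {t \<in> D. S t = 0}"
      using cell_map_in[OF a] by auto
    then have "finite (cell_map N x y a ` ?Z)" using fin by (rule finite_subset)
    then have "finite ?Z" by (rule finite_imageD) (rule inj, auto)
    then have "infinite (rough_points w - ?Z)" using inf by simp
    moreover have "rough_points w - ?Z \<subseteq> D" by (auto simp: rough_points_def)
    ultimately have "infinite (cell_map N x y a ` (rough_points w - ?Z))"
      using inj finite_imageD by blast
    moreover have "cell_map N x y a ` (rough_points w - ?Z) \<subseteq> rough_points (a # w)"
      using rough_points_Cons[OF a w] by (auto simp: rough_points_def)
    ultimately show ?case using infinite_super by blast
  qed (rule inf_Nil)
  then obtain t where "t \<in> rough_points w" by (metis all_not_in_conv finite.emptyI)
  then obtain u where "u \<in> words N 0" "rough (w @ u)" unfolding rough_points_def by blast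
  then show ?thesis by (simp add: words_def)
qed

section \<open>Growth of the oscillation sums\<close>

text \<open>Weighting the local sums by a left subeigenvector turns the recursion into
  \<open>a\<^sub>p\<^sub>+\<^sub>1 \<ge> \<rho> a\<^sub>p - K N\<^sup>p\<close>. With \<open>b = K / (\<rho> - N)\<close> the difference \<open>a\<^sub>p - b N\<^sup>p\<close> is multiplied
  by at least \<open>\<rho>\<close> in each step, and roughness makes it positive at some generation.\<close>

lemma osc_sum_growth:
  assumes n: "1 \<le> n" and gt: "real N < radius n" and r: "\<And>w. w \<in> words N n \<Longrightarrow> rough w"
  obtains c p0 where "0 < c" "\<And>p. p0 \<le> p \<Longrightarrow> c * radius n ^ p \<le> osc_sum N x y f p"
proof -
  let ?\<rho> = "radius n"
  obtain l where l: "\<And>w. w \<in> words N n \<Longrightarrow> 0 \<le> l w" "\<exists>w\<in>words N n. 0 < l w"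
    "\<And>j. j \<in> words N n \<Longrightarrow> ?\<rho> * l j \<le> (\<Sum>i\<in>words N n. l i * lower_entry N x y S i j)"
    using radius_left_weights[of n] by blast
  define a where "a p = (\<Sum>i\<in>words N n. l i * local_osc_sum p i)" for p
  define K where "K = (\<Sum>i\<in>words N n. l i) * (defect * card (letters N))"
  define b where "b = K / (?\<rho> - N)"
  have nonneg: "0 \<le> local_osc_sum p i" if "i \<in> words N n" for p i
    using that by (intro local_osc_sum_nonneg) (auto simp: words_def)
  have step: "?\<rho> * a p - K * real N ^ p \<le> a (Suc p)" for p
  proof -
    have "?\<rho> * a p = (\<Sum>j\<in>words N n. (?\<rho> * l j) * local_osc_sum p j)"
      by (simp add: a_def sum_distrib_left mult_ac)
    also have "\<dots> \<le> (\<Sum>j\<in>words N n. (\<Sum>i\<in>words N n. l i * lower_entry N x y S i j) * local_osc_sum p j)"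
      by (intro sum_mono mult_right_mono l(3) nonneg)
    also have "\<dots> = (\<Sum>i\<in>words N n. l i * (\<Sum>j\<in>words N n. lower_entry N x y S i j * local_osc_sum p j))"
      unfolding sum_distrib_right sum_distrib_left by (subst sum.swap) (simp add: mult_ac)
    finally have "?\<rho> * a p - K * real N ^ p \<le> (\<Sum>i\<in>words N n. l i *
        ((\<Sum>j\<in>words N n. lower_entry N x y S i j * local_osc_sum p j) - defect * card (letters N) * real N ^ p))"
      unfolding right_diff_distrib sum_subtractf sum_distrib_right[symmetric] K_def
      by (simp add: mult.assoc)
    also have "\<dots> \<le> a (Suc p)"
      unfolding a_def by (intro sum_mono mult_left_mono local_osc_sum_Suc[OF _ n] l(1))
    finally show ?thesis .
  qed
  have bK: "K = (?\<rho> - N) * b" using gt by (simp add: b_def)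
  have grow: "?\<rho> * (a p - b * real N ^ p) \<le> a (Suc p) - b * real N ^ Suc p" for p
    using step[of p] by (simp add: bK algebra_simps)
  obtain k where k: "k \<in> words N n" "0 < l k" using l(2) by blast
  obtain p1 where "b / l k * real N ^ p1 < local_osc_sum p1 k"
    using r[OF k(1)] unfolding rough_def by blast
  then have "b * real N ^ p1 < l k * local_osc_sum p1 k" using k(2) by (simp add: field_simps)
  also have "\<dots> \<le> a p1"
    unfolding a_def using k l(1) nonneg by (intro member_le_sum finite_words mult_nonneg_nonneg) auto
  finally have start: "0 < a p1 - b * real N ^ p1" by simp
  define e where "e = a p1 - b * real N ^ p1"
  have \<rho>: "0 < ?\<rho>" using gt N_pos by linarith
  have iter: "?\<rho> ^ m * e \<le> a (p1 + m) - b * real N ^ (p1 + m)" for m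
  proof (induction m)
    case (Suc m)
    have "?\<rho> ^ Suc m * e = ?\<rho> * (?\<rho> ^ m * e)" by simp
    also have "\<dots> \<le> ?\<rho> * (a (p1 + m) - b * real N ^ (p1 + m))"
      using Suc \<rho> by (intro mult_left_mono) auto
    also have "\<dots> \<le> a (p1 + Suc m) - b * real N ^ (p1 + Suc m)" using grow[of "p1 + m"] by simp
    finally show ?case .
  qed (simp add: e_def)
  have b0: "0 \<le> b"
    unfolding b_def K_def using gt l(1) defect_nonneg
    by (intro divide_nonneg_pos mult_nonneg_nonneg sum_nonneg) auto
  define M where "M = (\<Sum>w\<in>words N n. l w)"
  have lM: "l w \<le> M" if "w \<in> words N n" for w
    unfolding M_def using that l(1) by (intro member_le_sum finite_words) auto
  have M: "0 < M" using lM[OF k(1)] k(2) by simp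
  have total: "a p \<le> M * osc_sum N x y f (n + p)" for p
  proof -
    have "a p \<le> (\<Sum>i\<in>words N n. M * local_osc_sum p i)"
      unfolding a_def by (intro sum_mono mult_right_mono lM nonneg)
    also have "\<dots> = M * osc_sum N x y f (n + p)"
      unfolding osc_sum_eq local_osc_sum_add by (simp add: sum_distrib_left)
    finally show ?thesis .
  qed
  show thesis
    \<comment> \<open>The power of \<open>\<rho>\<close> compensates the shift from generation \<open>n + p1 + m\<close> to \<open>m\<close>.\<close>
  proof (rule that[of "e / (M * ?\<rho> ^ (n + p1))" "n + p1"])
    show "0 < e / (M * ?\<rho> ^ (n + p1))" using start \<rho> M by (simp add: e_def)
    fix p assume "n + p1 \<le> p"
    then obtain m where m: "p = (n + p1) + m" using le_Suc_ex by blast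
    have "?\<rho> ^ m * e \<le> a (p1 + m)" using iter[of m] b0 by (smt (verit) mult_nonneg_nonneg of_nat_0_le_iff zero_le_power)
    also have "\<dots> \<le> M * osc_sum N x y f p" using total[of "p1 + m"] by (simp add: m add.assoc)
    finally have "?\<rho> ^ m * e / M \<le> osc_sum N x y f p" using M by (simp add: divide_le_eq mult.commute)
    moreover have "e / (M * ?\<rho> ^ (n + p1)) * ?\<rho> ^ p = ?\<rho> ^ m * e / M"
      using \<rho> M unfolding m power_add by (simp add: field_simps)
    ultimately show "e / (M * ?\<rho> ^ (n + p1)) * ?\<rho> ^ p \<le> osc_sum N x y f p" by simp
  qed
qed

section \<open>The lower box dimension\<close>

lemma lower_box_dim_ge_2: "ereal 2 \<le> lower_box_dim (graph_over D f)"
proof -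
  have "ereal (ln (real N ^ 2) / ln N) \<le> lower_box_dim (graph_over D f)"
  proof (rule lower_box_dim_ge[OF X.two_le_N width_pos, of "1 / 4" _ 0])
    fix p and \<epsilon> :: real assume eps: "0 < \<epsilon>" "\<epsilon> \<le> width / real N ^ p"
    have "(real N ^ 2) ^ p = (\<Sum>w\<in>words N p. 1)" by (simp add: card_words card_letters)
    also have "\<dots> \<le> (\<Sum>w\<in>words N p. max 1 (cell_osc w / \<epsilon>))" by (intro sum_mono) simp
    also have "\<dots> \<le> 4 * mesh_count (graph_over D f) \<epsilon>" by (rule osc_sum_le_mesh_count[OF f_continuous eps])
    finally show "1 / 4 * (real N ^ 2) ^ p \<le> mesh_count (graph_over D f) \<epsilon>" by simp
  qed (use X.two_le_N in auto)
  then show ?thesis using X.two_le_N by (simp add: ln_realpow)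
qed

lemma lower_box_dim_ge_radius:
  assumes n: "1 \<le> n" and gt: "real N < radius n" and r: "\<And>w. w \<in> words N n \<Longrightarrow> rough w"
  shows "ereal (1 + ln (radius n) / ln N) \<le> lower_box_dim (graph_over D f)"
proof -
  obtain c p0 where c: "0 < c" "\<And>p. p0 \<le> p \<Longrightarrow> c * radius n ^ p \<le> osc_sum N x y f p"
    using osc_sum_growth[OF assms] by blast
  have N: "1 < real N" using X.two_le_N by simp
  have "ereal (ln (N * radius n) / ln N) \<le> lower_box_dim (graph_over D f)"
  proof (rule lower_box_dim_ge[OF X.two_le_N width_pos, of "c / (4 * width)" _ p0])
    show "0 < c / (4 * width)" using c width_pos by simp
    show "1 \<le> N * radius n" using N gt mult_mono[of 1 "real N" 1 "radius n"] by simp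
    fix p and \<epsilon> :: real assume p: "p0 \<le> p" and eps: "0 < \<epsilon>" "\<epsilon> \<le> width / real N ^ p"
    have "c * (N * radius n) ^ p / width = (c * radius n ^ p) / (width / real N ^ p)"
      by (simp add: power_mult_distrib)
    also have "\<dots> \<le> osc_sum N x y f p / (width / real N ^ p)"
      using c(2)[OF p] width_pos by (intro divide_right_mono) auto
    also have "\<dots> \<le> osc_sum N x y f p / \<epsilon>"
      using eps width_pos N_pos local_osc_sum_nonneg[of "[]" p]
      by (intro divide_left_mono) (auto simp: osc_sum_eq)
    also have "\<dots> \<le> (\<Sum>w\<in>words N p. max 1 (cell_osc w / \<epsilon>))"
      unfolding osc_sum_def sum_divide_distrib by (intro sum_mono) simp
    also have "\<dots> \<le> 4 * mesh_count (graph_over D f) \<epsilon>"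
      by (rule osc_sum_le_mesh_count[OF f_continuous eps])
    finally have "c * (N * radius n) ^ p / width \<le> 4 * real (mesh_count (graph_over D f) \<epsilon>)"
      by simp
    from divide_right_mono[OF this, of 4]
    show "c / (4 * width) * (N * radius n) ^ p \<le> mesh_count (graph_over D f) \<epsilon>" by simp
  qed
  moreover have "ln (N * radius n) / ln N = 1 + ln (radius n) / ln N"
    using N gt by (simp add: ln_mult add_divide_distrib)
  ultimately show ?thesis by simp
qed

text \<open>The trivial bound 2 settles \<open>\<rho>\<^sub>* \<le> N\<close>. Otherwise the spectral radii exceed \<open>N\<close> from some word
  length on, and their bounds converge to the one for \<open>\<rho>\<^sub>*\<close>.\<close>

lemma lower_box_dim_ge_rho_star:
  assumes r: "\<And>w. set w \<subseteq> letters N \<Longrightarrow> rough w"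
  shows "ereal (1 + ln (rho_star N x y S) / ln N) \<le> lower_box_dim (graph_over D f)"
proof (cases "rho_star N x y S \<le> N")
  case True
  have N: "0 < ln (real N)" using X.two_le_N by simp
  have "ln (rho_star N x y S) \<le> ln N"
  proof (cases "rho_star N x y S = 0")
    case False
    then show ?thesis using True rho_star_nonneg by simp
  qed (use N in simp)
  then have "1 + ln (rho_star N x y S) / ln N \<le> 2" using N by (simp add: divide_le_eq)
  then show ?thesis using lower_box_dim_ge_2 by (meson ereal_less_eq(3) order_trans)
next
  case False
  then have gt: "real N < rho_star N x y S" by simp
  have "((\<lambda>n. ereal (1 + ln (radius n) / ln N)) \<longlongrightarrow> ereal (1 + ln (rho_star N x y S) / ln N)) sequentially"
    using gt X.two_le_N by (intro tendsto_intros tendsto_ereal radius_tendsto) auto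
  moreover have "\<forall>\<^sub>F n in sequentially. ereal (1 + ln (radius n) / ln N) \<le> lower_box_dim (graph_over D f)"
    using order_tendstoD(1)[OF radius_tendsto gt] eventually_ge_at_top[of 1]
  proof eventually_elim
    case (elim n)
    then show ?case by (intro lower_box_dim_ge_radius r) (auto simp: words_def)
  qed
  ultimately show ?thesis by (intro tendsto_upperbound) auto
qed

end

theorem theorem4p3:
  fixes N :: nat
    and x y :: "nat \<Rightarrow> real"
    and z :: "nat \<Rightarrow> nat \<Rightarrow> real"
    and g h S q f :: "real \<times> real \<Rightarrow> real"
    and lambdaS lambdaq :: real
  assumes "N \<ge> 2"
    and "strict_mono_on {0..N} x"
    and "strict_mono_on {0..N} y"
    and "\<And>i. i \<in> {1..N} \<Longrightarrow> x i - x (i - 1) = (x N - x 0) / real N"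
    and "\<And>i. i \<in> {1..N} \<Longrightarrow> y i - y (i - 1) = (y N - y 0) / real N"
    and "x N - x 0 = y N - y 0"
    and "continuous_on (rect_domain N x y) g"
    and "continuous_on (rect_domain N x y) h"
    and "continuous_on (rect_domain N x y) S"
    and "\<And>i j. i \<in> {0, N} \<Longrightarrow> j \<in> {0, N} \<Longrightarrow> g (x i, y j) = z i j"
    and "\<And>i j. i \<le> N \<Longrightarrow> j \<le> N \<Longrightarrow> h (x i, y j) = z i j"
    and "\<And>t. t \<in> rect_domain N x y \<Longrightarrow> \<bar>S t\<bar> < 1"
    and "\<And>w t. w \<in> letters N \<Longrightarrow> t \<in> cell x y w \<Longrightarrow>
           q t = h t - S t * g (inv_into (rect_domain N x y) (cell_map N x y w) t)"
    and "continuous_on (rect_domain N x y) f"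
    and "\<And>i j. i \<le> N \<Longrightarrow> j \<le> N \<Longrightarrow> f (x i, y j) = z i j"
    and "graph_over (rect_domain N x y) f =
           (\<Union>w\<in>letters N. graph_map N x y S q w ` graph_over (rect_domain N x y) f)"
    and "lambdaS > 0" and "lambdaS-lipschitz_on (rect_domain N x y) S"
    and "lambdaq > 0" and "lambdaq-lipschitz_on (rect_domain N x y) q"
    and "(sum_fun_min N x y S \<ge> 1 \<and> finite {t \<in> rect_domain N x y. S t = 0}) \<or>
         ((\<forall>t\<in>rect_domain N x y. S t > 0) \<or> (\<forall>t\<in>rect_domain N x y. S t < 0))"
    and "limsup (\<lambda>p. ereal (osc_sum N x y f p / real N ^ p)) = \<infinity>"
  shows "lower_box_dim (graph_over (rect_domain N x y) f)
           \<ge> ereal (1 + ln (rho_star N x y S) / ln (real N))"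
proof -
  have self_affine: "f (cell_map N x y w t) = S (cell_map N x y w t) * f t + q (cell_map N x y w t)"
    if w: "w \<in> letters N" and t: "t \<in> rect_domain N x y" for w t
  proof -
    have "(fst t, snd t, f t) \<in> graph_over (rect_domain N x y) f"
      using t by (auto simp: graph_over_def)
    then have "graph_map N x y S q w (fst t, snd t, f t) \<in> graph_over (rect_domain N x y) f"
      using w assms(16) by blast
    then show ?thesis by (auto simp: graph_map_def graph_over_def cell_map_def)
  qed
  interpret self_affine_surface N x y S f q lambdaS lambdaq
  proof unfold_locales
    show "x 0 < x N" "y 0 < y N" using assms(1-3) by (auto simp: strict_mono_on_def)
  qed (use assms self_affine in auto)
  have r: "rough []" using assms(22) by (rule rough_Nil)
  have "rough w" if w: "set w \<subseteq> letters N" for w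
  proof (cases "sum_fun_min N x y S \<ge> 1 \<and> finite {t \<in> D. S t = 0}")
    case True
    have "1 \<le> sum_fun N x y S t" if t: "t \<in> D" for t
    proof -
      have "sum_fun_min N x y S \<le> sum_fun N x y S t"
        unfolding sum_fun_min_def using t
        by (intro cINF_lower bdd_belowI[of _ 0]) (auto simp: sum_fun_def intro!: sum_nonneg)
      then show ?thesis using True by simp
    qed
    then show ?thesis using all_rough_of_sum_fun[OF r _ _ w] True by blast
  next
    case False
    then have "S t \<noteq> 0" if "t \<in> D" for t using assms(21) that by force
    then show ?thesis using all_rough_of_no_zero[OF r _ w] by blast
  qed
  then show ?thesis by (rule lower_box_dim_ge_rho_star)
qed

end
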